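(* Let $n\ge 1$, let $F_n=\{a_1,a_2,\dots,a_n\}$ with $0<a_1<a_2<\cdots<a_n<\pi$, and let $q,\tilde q\in L^2(0,\pi)$. Define $G_n(\rho)=\sum_{i=1}^n\sin(\rho a_i)$ and let $Z(G_n)$ denote the set of zeros of $G_n$. Suppose the following conditions are satisfied: (i) $Z(G_n)\cap\mathbb N=\emptyset$; (ii) $\Lambda(q,F_n)=\Lambda(\tilde q,F_n)$. Then $q(x)=\tilde q(x)$ for almost every $x\in(0,\pi)$. In particular, for $n=1$, condition (i) is equivalent to $\pi/a_1\notin\mathbb Q$.
   Context: Here $\mathbb N=\{1,2,3,\dots\}$, and potentials may be complex-valued. For $q\in L^2(0,\pi)$ and $F_n=\{a_1,\dots,a_n\}$, $L(q,F_n,0,0)$ denotes the boundary value problem $$-y''(x)+q(x)\sum_{i=1}^n y(a_i)=\lambda y(x),\quad 0<x<\pi,\qquad y(0)=0=y(\pi),$$ where $\lambda\in\mathbb C$ is the spectral parameter. Write $\lambda=\rho^2$ and, for $x\in[0,\pi]$, set $$s(x)=\frac{\sin\rho x}{\rho},\qquad I(x)=\int_0^{x}q(t)\frac{\sin\rho(x-t)}{\rho}\,dt$$ (even entire functions of $\rho$, hence entire functions of $\lambda$; the values at $\rho=0$ are understood by continuity). The characteristic function of $L(q,F_n,0,0)$ is the entire function $\triangle_n(\lambda)=\det K_n(\lambda)$, where $K_n(\lambda)$ is the $(n+1)\times(n+1)$ matrix $$K_n(\lambda)=\begin{bmatrix} s(a_1)& I(a_1)-1 & I(a_1)&\cdots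 & I(a_1)\\ s(a_2)& I(a_2)& I(a_2)-1&\cdots & I(a_2)\\ \vdots&\vdots&\vdots&\ddots&\vdots\\ s(a_n)& I(a_n)& I(a_n)&\cdots& I(a_n)-1\\ s(\pi)& I(\pi)& I(\pi)&\cdots & I(\pi)\end{bmatrix},$$ i.e. for $1\le j\le n$ row $j$ has first entry $s(a_j)$ and, for $1\le i\le n$, entry $I(a_j)-\delta_{ij}$ in column $i+1$; the last row has first entry $s(\pi)$ and all other entries $I(\pi)$. A number $\lambda$ is an eigenvalue of $L(q,F_n,0,0)$ if and only if $\triangle_n(\lambda)=0$. $\Lambda(q,F_n)=\{\lambda_m\}_{m\ge1}$ denotes the eigenvalues of $L(q,F_n,0,0)$, counted with multiplicity as zeros of $\triangle_n$; equality $\Lambda(q,F_n)=\Lambda(\tilde q,F_n)$ means equality of these collections counted with multiplicity. *)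

theory Defs
  imports
    "HOL-Complex_Analysis.Complex_Analysis"
    "Jordan_Normal_Form.Determinant"
begin

text \<open>
  Potentials are functions \<open>q :: real \<Rightarrow> complex\<close>, of which only the values on \<open>(0,\<pi>)\<close> matter.
  The point set \<open>F\<^sub>n = {a\<^sub>1 < \<dots> < a\<^sub>n}\<close> is given by \<open>n\<close> and its increasing enumeration
  \<open>a :: nat \<Rightarrow> real\<close>, of which only \<open>a 1, \<dots>, a n\<close> matter.
\<close>

definition frozen_points :: "nat \<Rightarrow> (nat \<Rightarrow> real) \<Rightarrow> bool" where
  "frozen_points n a \<longleftrightarrow>
     strict_mono_on {1..n} a \<and> (\<forall>i\<in>{1..n}. 0 < a i \<and> a i < pi)"

definition L2_potential :: "(real \<Rightarrow> complex) \<Rightarrow> bool" where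
  "L2_potential q \<longleftrightarrow>
     q \<in> borel_measurable (lebesgue_on {0<..<pi}) \<and>
     integrable (lebesgue_on {0<..<pi}) (\<lambda>x. (norm (q x))\<^sup>2)"

text \<open>
  Solutions of \<open>-y'' + q \<Sum>\<^sub>i y(a\<^sub>i) = lam y\<close>, \<open>y(0) = 0 = y(\<pi>)\<close>, are understood in the
  Caratheodory sense: \<open>y\<close> is differentiable on \<open>[0,\<pi>]\<close>, \<open>y'\<close> is absolutely continuous (that is,
  \<open>y'\<close> is the indefinite integral of an integrable function \<open>y''\<close>), and the equation holds almost
  everywhere.
\<close>

definition bvp_solution ::
  "nat \<Rightarrow> (nat \<Rightarrow> real) \<Rightarrow> (real \<Rightarrow> complex) \<Rightarrow> complex \<Rightarrow> (real \<Rightarrow> complex) \<Rightarrow> bool" where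
  "bvp_solution n a q lam y \<longleftrightarrow>
     (\<exists>y1 y2.
        (\<forall>x\<in>{0..pi}. (y has_vector_derivative y1 x) (at x within {0..pi})) \<and>
        y2 absolutely_integrable_on {0..pi} \<and>
        (\<forall>x\<in>{0..pi}. y1 x = y1 0 + (LINT t:{0..x}|lebesgue. y2 t)) \<and>
        (AE x in lebesgue_on {0<..<pi}. - y2 x + q x * (\<Sum>i=1..n. y (a i)) = lam * y x)) \<and>
     y 0 = 0 \<and> y pi = 0"

definition bvp_eigenvalue ::
  "nat \<Rightarrow> (nat \<Rightarrow> real) \<Rightarrow> (real \<Rightarrow> complex) \<Rightarrow> complex \<Rightarrow> bool" where
  "bvp_eigenvalue n a q lam \<longleftrightarrow> (\<exists>y. bvp_solution n a q lam y \<and> (\<exists>x\<in>{0..pi}. y x \<noteq> 0))"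

definition s_fun :: "complex \<Rightarrow> real \<Rightarrow> complex" where
  "s_fun \<rho> x = (if \<rho> = 0 then of_real x else sin (\<rho> * of_real x) / \<rho>)"

definition I_fun :: "(real \<Rightarrow> complex) \<Rightarrow> complex \<Rightarrow> real \<Rightarrow> complex" where
  "I_fun q \<rho> x = (LINT t:{0..x}|lebesgue. q t * s_fun \<rho> (x - t))"

text \<open>
  Both functions are even in \<open>\<rho>\<close>, so the choice of the square root of \<open>lam\<close> in the next definition
  is immaterial.
\<close>

lemma s_fun_minus: "s_fun (- \<rho>) x = s_fun \<rho> x"
  by (simp add: s_fun_def)

lemma I_fun_minus: "I_fun q (- \<rho>) x = I_fun q \<rho> x"
  by (simp add: I_fun_def s_fun_minus)

text \<open>
  Matrix indices start at 0: for \<open>r < n\<close> row \<open>r\<close> belongs to the point \<open>a (r + 1)\<close>, row \<open>n\<close> belongs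
  to \<open>\<pi>\<close>, and column \<open>c \<ge> 1\<close> belongs to the summand \<open>y (a c)\<close>. The entry with \<open>c = r + 1\<close> does not
  occur in the last row.
\<close>

definition K_mat ::
  "nat \<Rightarrow> (nat \<Rightarrow> real) \<Rightarrow> (real \<Rightarrow> complex) \<Rightarrow> complex \<Rightarrow> complex Matrix.mat" where
  "K_mat n a q lam =
     Matrix.mat (n + 1) (n + 1) (\<lambda>(r, c).
       let \<rho> = csqrt lam; x = (if r < n then a (r + 1) else pi) in
       if c = 0 then s_fun \<rho> x
       else I_fun q \<rho> x - (if c = r + 1 then 1 else 0))"

definition char_fun :: "nat \<Rightarrow> (nat \<Rightarrow> real) \<Rightarrow> (real \<Rightarrow> complex) \<Rightarrow> complex \<Rightarrow> complex" where
  "char_fun n a q lam = Determinant.det (K_mat n a q lam)"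

text \<open>
  The collection \<open>\<Lambda>(q, F\<^sub>n)\<close> of eigenvalues counted with multiplicity is an infinite multiset,
  represented by its multiplicity function; the multiplicity of an eigenvalue is its order as a zero
  of the characteristic function.
\<close>

definition spectrum_mult :: "nat \<Rightarrow> (nat \<Rightarrow> real) \<Rightarrow> (real \<Rightarrow> complex) \<Rightarrow> complex \<Rightarrow> nat" where
  "spectrum_mult n a q lam =
     (if bvp_eigenvalue n a q lam then nat (zorder (char_fun n a q) lam) else 0)"

definition G_fun :: "nat \<Rightarrow> (nat \<Rightarrow> real) \<Rightarrow> complex \<Rightarrow> complex" where
  "G_fun n a \<rho> = (\<Sum>i=1..n. sin (\<rho> * of_real (a i)))"

definition G_zeros :: "nat \<Rightarrow> (nat \<Rightarrow> real) \<Rightarrow> complex set" where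
  "G_zeros n a = {\<rho>. G_fun n a \<rho> = 0}"

end

theory Submission
  imports Defs
begin

text \<open>
  Write \<open>\<Delta>\<close> for the characteristic function. Expanding the determinant gives
  \<open>\<Delta> = s(\<pi>) + \<Sum>\<^sub>i (s(a\<^sub>i) I(\<pi>) - s(\<pi>) I(a\<^sub>i))\<close> (\<open>det_frozen_matrix\<close>).
  Two consequences of this formula carry the proof.

  First, at \<open>\<rho> = k\<close> with \<open>k\<close> a positive integer the terms with \<open>s(\<pi>)\<close> disappear, and
  \<open>\<Delta>(k\<^sup>2) = G\<^sub>n(k)/k \<sqdot> I(\<pi>)\<close>, where \<open>I(\<pi>)\<close> is, up to a factor \<open>\<plusminus> 1/k\<close>, the \<open>k\<close>-th sine
  coefficient of \<open>q\<close>. If no \<open>G\<^sub>n(k)\<close> vanishes, then \<open>\<Delta>\<close> determines all sine coefficients of \<open>q\<close>,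
  and hence \<open>q\<close> by completeness of the sines (\<open>sine_transform_injective\<close>,
  \<open>potential_determined_by_char_fun\<close>).

  Second, each summand \<open>s(a) I(\<pi>) - s(\<pi>) I(a)\<close> is the integral of \<open>q\<close> against a kernel of Green
  type, of size \<open>exp (\<pi> \<bar>Im \<rho>\<bar>) / \<bar>\<rho>\<bar>\<^sup>2\<close>. Therefore \<open>\<Delta>\<close> is asymptotic to \<open>s(\<pi>)\<close> on the boundaries
  of large squares that avoid the zeros of \<open>s(\<pi>)\<close>, independently of \<open>q\<close>. If two potentials have the
  same zeros of \<open>\<Delta>\<close> with the same orders, then the quotient of their characteristic functions is
  entire and tends to 1 on these squares, so it is 1 by the maximum principle
  (\<open>zorder_determines_char_fun\<close>): the spectrum determines \<open>\<Delta>\<close>.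

  Multiplicities count only eigenvalues of the boundary value problem. To read off the zero orders of
  \<open>\<Delta>\<close> from them, one has to know that every zero of \<open>\<Delta>\<close> is an eigenvalue
  (\<open>char_fun_zero_imp_eigenvalue\<close>); a solution is written down explicitly as a combination of \<open>s\<close>
  and \<open>I\<close>.
\<close>

section \<open>The characteristic determinant\<close>

text \<open>
  The matrix is the sum of a signed partial permutation matrix, carrying the \<open>-1\<close> entries, the
  column \<open>s\<close>, and a matrix of rank one, so its determinant is affine in \<open>I\<close>. The explicit value
  comes from row and column operations.
\<close>

lemma det_frozen_matrix:
  fixes s I :: "nat \<Rightarrow> 'a :: field"
  assumes n: "n \<ge> 1"
  shows "Determinant.det (Matrix.mat (n + 1) (n + 1)
           (\<lambda>(r, c). if c = 0 then s r else I r - (if c = r + 1 then 1 else 0)))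
         = s n + (\<Sum>r<n. s r * I n - s n * I r)"
proof -
  define K where "K = Matrix.mat (n + 1) (n + 1)
           (\<lambda>(r, c). if c = 0 then s r else I r - (if c = r + 1 then 1 else 0))"
  \<comment> \<open>Left multiplication by \<open>P\<close> adds the rows \<open>1, \<dots>, n - 1\<close> to row 0; right multiplication by
    \<open>Q\<close> subtracts column 1 from every later column.\<close>
  define P where "P = Matrix.mat (n + 1) (n + 1)
           (\<lambda>(r, c). if r = c \<or> (r = 0 \<and> c < n) then 1 else 0 :: 'a)"
  define Q where "Q = Matrix.mat (n + 1) (n + 1)
           (\<lambda>(r, c). if r = c then 1 else if r = 1 \<and> c \<ge> 2 then -1 else 0 :: 'a)"
  have K: "K \<in> carrier_mat (n + 1) (n + 1)" and P: "P \<in> carrier_mat (n + 1) (n + 1)"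
    and Q: "Q \<in> carrier_mat (n + 1) (n + 1)"
    by (simp_all add: K_def P_def Q_def)
  have Kent: "K $$ (r, c) = (if c = 0 then s r else I r - (if c = r + 1 then 1 else 0))"
    if "r < n + 1" "c < n + 1" for r c
    using that by (simp add: K_def)
  have entry: "(M * N) $$ (r, c) = (\<Sum>j<n+1. M $$ (r, j) * N $$ (j, c))"
    if "M \<in> carrier_mat (n + 1) (n + 1)" "N \<in> carrier_mat (n + 1) (n + 1)" "r < n + 1" "c < n + 1"
    for M N :: "'a mat" and r c
    using that by (simp add: scalar_prod_def atLeast0LessThan)
  have detP: "Determinant.det P = 1"
  proof -
    have "upper_triangular P" by (auto simp: P_def upper_triangular_def)
    then have "Determinant.det P = prod_list (diag_mat P)" by (rule det_upper_triangular[OF _ P])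
    also have "\<dots> = 1" by (auto simp: prod_list_diag_prod P_def intro!: prod.neutral)
    finally show ?thesis .
  qed
  have detQ: "Determinant.det Q = 1"
  proof -
    have "upper_triangular Q" by (auto simp: Q_def upper_triangular_def)
    then have "Determinant.det Q = prod_list (diag_mat Q)" by (rule det_upper_triangular[OF _ Q])
    also have "\<dots> = 1" by (auto simp: prod_list_diag_prod Q_def intro!: prod.neutral)
    finally show ?thesis .
  qed
  have PK: "(P * K) $$ (r, c) =
      (if r = 0 then if c = 0 then \<Sum>j<n. s j else (\<Sum>j<n. I j) - 1
       else K $$ (r, c))" if "r < n + 1" "c < n + 1" for r c
  proof -
    have "(P * K) $$ (r, c) = (\<Sum>j<n+1. P $$ (r, j) * K $$ (j, c))"
      using entry[OF P K that] .
    also have "\<dots> = (if r = 0 then if c = 0 then \<Sum>j<n. s j else (\<Sum>j<n. I j) - 1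
       else K $$ (r, c))"
    proof (cases "r = 0")
      case True
      have "(\<Sum>j<n+1. P $$ (r, j) * K $$ (j, c)) = (\<Sum>j<n. K $$ (j, c))"
        using that n True by (simp add: P_def)
      also have "\<dots> = (\<Sum>j<n. if c = 0 then s j else I j - (if c - 1 = j then 1 else 0))"
        using that by (intro sum.cong) (auto simp: K_def)
      also have "\<dots> = (if c = 0 then \<Sum>j<n. s j else (\<Sum>j<n. I j) - 1)"
        using that by (auto simp: sum_subtractf)
      finally show ?thesis using True by simp
    next
      case False
      have "(\<Sum>j<n+1. P $$ (r, j) * K $$ (j, c)) = (\<Sum>j<n+1. if j = r then K $$ (j, c) else 0)"
        using that False by (intro sum.cong) (auto simp: P_def)
      then show ?thesis using that False by simp
    qed
    finally show ?thesis .
  qed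
  have PKQ: "(P * K * Q) $$ (r, c) = (P * K) $$ (r, c) - (if c \<ge> 2 then (P * K) $$ (r, 1) else 0)"
    if "r < n + 1" "c < n + 1" for r c
  proof -
    have "(P * K * Q) $$ (r, c) = (\<Sum>j<n+1. (P * K) $$ (r, j) * Q $$ (j, c))"
      using entry[OF mult_carrier_mat[OF P K] Q that] .
    also have "\<dots> = (\<Sum>j<n+1. (if j = c then (P * K) $$ (r, j) else 0)
          - (if j = 1 then if c \<ge> 2 then (P * K) $$ (r, j) else 0 else 0))"
      using that by (intro sum.cong) (auto simp: Q_def)
    also have "\<dots> = (P * K) $$ (r, c) - (if c \<ge> 2 then (P * K) $$ (r, 1) else 0)"
      using that n by (auto simp: sum_subtractf)
    finally show ?thesis .
  qed
  \<comment> \<open>What remains of \<open>P * K * Q\<close>, once its last row has been moved to the front, is block lower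
    triangular, with a 2 by 2 block \<open>A\<close> and a negative identity on the diagonal.\<close>
  define A where "A = Matrix.mat 2 2 (\<lambda>(r, c).
     if r = 0 then if c = 0 then s n else I n
     else if c = 0 then (\<Sum>j<n. s j) else (\<Sum>j<n. I j) - 1)"
  define C where "C = Matrix.mat (n - 1) 2 (\<lambda>(r, c).
     if c = 0 then s (r + 1) else I (r + 1))"
  have PKQ_carrier: "P * K * Q \<in> carrier_mat (n + 1) (n + 1)"
    using P K Q by (intro mult_carrier_mat)
  have front: "swap_row_to_front (P * K * Q) n
      = four_block_mat A (0\<^sub>m 2 (n - 1)) C (-1 \<cdot>\<^sub>m 1\<^sub>m (n - 1))"
  proof (subst swap_row_to_front_result[OF PKQ_carrier], simp, rule eq_matI, goal_cases)
    case (1 i j)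
    then have ij: "i < n + 1" "j < n + 1" using n by (auto simp: A_def)
    have entries: "(P * K * Q) $$ (r, c) =
        (if r = 0 then if c = 0 then \<Sum>j<n. s j else if c = 1 then (\<Sum>j<n. I j) - 1 else 0
         else if c = 0 then s r else if c = 1 then I r else if c = r + 1 then -1 else 0)"
      if "r < n + 1" "c < n + 1" for r c
      using that n by (auto simp: PKQ PK Kent simp del: index_mult_mat)
    show ?case
    proof (cases "i < 2")
      case True
      then show ?thesis
        using ij n by (auto simp: entries A_def C_def simp del: index_mult_mat)
    next
      case False
      then obtain k where "i = k + 2" by (metis add.commute le_Suc_ex not_less)
      then show ?thesis
        using ij n by (auto simp: entries A_def C_def simp del: index_mult_mat)
    qed
  qed (use n in \<open>auto simp: A_def\<close>)
  have "(-1) ^ n * Determinant.det K = (-1) ^ n * Determinant.det (P * K * Q)"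
    by (simp only: det_mult[OF mult_carrier_mat[OF P K] Q] det_mult[OF P K] detP detQ
        mult_1_left mult_1_right)
  also have "\<dots> = Determinant.det (swap_row_to_front (P * K * Q) n)"
    using swap_row_to_front_det[OF PKQ_carrier] by simp
  also have "\<dots> = Determinant.det A * Determinant.det (-1 \<cdot>\<^sub>m 1\<^sub>m (n - 1) :: 'a mat)"
    unfolding front by (rule det_four_block_mat_upper_right_zero) (auto simp: A_def C_def)
  also have "Determinant.det (-1 \<cdot>\<^sub>m 1\<^sub>m (n - 1) :: 'a mat) = (-1) ^ (n - 1)"
    by (simp add: Determinant.det_smult)
  also have "Determinant.det A = s n * ((\<Sum>j<n. I j) - 1) - I n * (\<Sum>j<n. s j)"
  proof -
    have "A = four_block_mat (Matrix.mat 1 1 (\<lambda>_. s n)) (Matrix.mat 1 1 (\<lambda>_. I n))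
       (Matrix.mat 1 1 (\<lambda>_. \<Sum>j<n. s j)) (Matrix.mat 1 1 (\<lambda>_. (\<Sum>j<n. I j) - 1))"
      by (rule eq_matI) (auto simp: A_def)
    also have "Determinant.det \<dots> = Determinant.det
       (Matrix.mat 1 1 (\<lambda>_. s n) * Matrix.mat 1 1 (\<lambda>_. (\<Sum>j<n. I j) - 1)
          - Matrix.mat 1 1 (\<lambda>_. I n) * Matrix.mat 1 1 (\<lambda>_. \<Sum>j<n. s j))"
      by (rule det_four_block_mat[where n = 1])
         (auto simp: scalar_prod_def mult.commute intro!: eq_matI)
    also have "\<dots> = s n * ((\<Sum>j<n. I j) - 1) - I n * (\<Sum>j<n. s j)"
    proof (subst det_single)
      show "Matrix.mat 1 1 (\<lambda>_. s n) * Matrix.mat 1 1 (\<lambda>_. (\<Sum>j<n. I j) - 1)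
          - Matrix.mat 1 1 (\<lambda>_. I n) * Matrix.mat 1 1 (\<lambda>_. \<Sum>j<n. s j) \<in> carrier_mat 1 1"
        by (intro carrier_matI) auto
    qed (auto simp: scalar_prod_def)
    finally show ?thesis .
  qed
  also have "\<dots> * (-1) ^ (n - 1) = (-1) ^ n * (I n * (\<Sum>j<n. s j) - s n * ((\<Sum>j<n. I j) - 1))"
    using n by (cases n) (auto simp: algebra_simps)
  finally have "Determinant.det K = I n * (\<Sum>j<n. s j) - s n * ((\<Sum>j<n. I j) - 1)"
    by simp
  then show ?thesis
    by (simp add: K_def sum_subtractf sum_distrib_left sum_distrib_right algebra_simps)
qed

lemma frozen_points_bounds:
  assumes "frozen_points n a" "i \<in> {1..n}"
  shows "0 \<le> a i" "a i \<le> pi"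
  using assms by (auto simp: frozen_points_def less_imp_le)

text \<open>
  The determinant as a function of \<open>\<rho>\<close> instead of \<open>\<rho>\<^sup>2\<close>: estimates and values at integers are
  natural in this variable.
\<close>

definition frozen_char :: "nat \<Rightarrow> (nat \<Rightarrow> real) \<Rightarrow> (real \<Rightarrow> complex) \<Rightarrow> complex \<Rightarrow> complex" where
  "frozen_char n a q \<rho> = s_fun \<rho> pi
     + (\<Sum>i=1..n. s_fun \<rho> (a i) * I_fun q \<rho> pi - s_fun \<rho> pi * I_fun q \<rho> (a i))"

lemma char_fun_csqrt:
  assumes "n \<ge> 1"
  shows "char_fun n a q lam = frozen_char n a q (csqrt lam)"
proof -
  define x where "x r = (if r < n then a (r + 1) else pi)" for r
  have "K_mat n a q lam = Matrix.mat (n + 1) (n + 1)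
     (\<lambda>(r, c). if c = 0 then s_fun (csqrt lam) (x r)
              else I_fun q (csqrt lam) (x r) - (if c = r + 1 then 1 else 0))"
    by (auto simp: K_mat_def x_def Let_def intro!: cong_mat)
  then have "char_fun n a q lam = s_fun (csqrt lam) (x n) +
     (\<Sum>r<n. s_fun (csqrt lam) (x r) * I_fun q (csqrt lam) (x n)
          - s_fun (csqrt lam) (x n) * I_fun q (csqrt lam) (x r))"
    unfolding char_fun_def by (simp only: det_frozen_matrix[OF assms])
  also have "\<dots> = frozen_char n a q (csqrt lam)"
    unfolding frozen_char_def
    by (simp add: x_def lessThan_atLeast0 sum.atLeast_Suc_atMost_Suc_shift sum.atLeast1_atMost_eq
             flip: atLeast0LessThan)
  finally show ?thesis .
qed

lemma char_fun_square:
  assumes "n \<ge> 1"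
  shows "char_fun n a q (\<rho>\<^sup>2) = frozen_char n a q \<rho>"
proof -
  have "csqrt (\<rho>\<^sup>2) = \<rho> \<or> csqrt (\<rho>\<^sup>2) = - \<rho>"
    by (metis power2_csqrt power2_eq_iff)
  then show ?thesis
    by (auto simp: char_fun_csqrt[OF assms] frozen_char_def s_fun_minus I_fun_minus)
qed

section \<open>Holomorphic dependence on the spectral parameter\<close>

lemma set_integrable_L2_potential:
  assumes "L2_potential q"
  shows "set_integrable lebesgue {0..pi} q"
proof -
  let ?M = "lebesgue_on {0<..<pi}"
  have "finite_measure ?M"
    by (rule finite_measure_lebesgue_on) (simp add: fmeasurable_def)
  then have "integrable ?M (\<lambda>x. 1 + (norm (q x))\<^sup>2)"
    using assms by (intro Bochner_Integration.integrable_add finite_measure.integrable_const)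
      (auto simp: L2_potential_def)
  moreover have "norm (q x) \<le> 1 + (norm (q x))\<^sup>2" for x
  proof (cases "norm (q x) \<le> 1")
    case False
    then have "norm (q x) * 1 \<le> norm (q x) * norm (q x)" by (intro mult_left_mono) auto
    then show ?thesis by (simp add: power2_eq_square)
  qed (simp add: add_increasing2)
  ultimately have "integrable ?M q"
    using assms by (elim Bochner_Integration.integrable_bound) (auto simp: L2_potential_def)
  then have "set_integrable lebesgue {0<..<pi} q"
    by (simp add: set_integrable_def integrable_restrict_space)
  then show ?thesis
    by (simp add: absolutely_integrable_on_Icc_iff_Ioo)
qed

lemma set_integrable_mult_continuous:
  fixes q k :: "real \<Rightarrow> complex"
  assumes q: "set_integrable lebesgue {a..b} q" and k: "continuous_on {a..b} k"
  shows "set_integrable lebesgue {a..b} (\<lambda>t. q t * k t)"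
proof -
  have "(\<lambda>t. k t * q t) absolutely_integrable_on {a..b}"
  proof (rule absolutely_integrable_bounded_measurable_product[OF bilinear_times])
    show "k \<in> borel_measurable (lebesgue_on {a..b})"
      by (rule continuous_imp_measurable_on_sets_lebesgue[OF k]) auto
    show "bounded (k ` {a..b})"
      by (intro compact_imp_bounded compact_continuous_image k) auto
  qed (use q in auto)
  then show ?thesis by (simp add: mult.commute)
qed

lemma sin_paired_complex:
  "(\<lambda>n. (- 1) ^ n / fact (2 * n + 1) * z ^ (2 * n + 1)) sums sin (z::complex)"
proof -
  have "(\<lambda>n. \<Sum>k = n * 2..<n * 2 + 2. sin_coeff k *\<^sub>R z ^ k) sums sin z"
    by (rule sums_group[OF sin_converges]) auto
  also have "(\<lambda>n. \<Sum>k = n * 2..<n * 2 + 2. sin_coeff k *\<^sub>R z ^ k)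
      = (\<lambda>n. (- 1) ^ n / fact (2 * n + 1) * z ^ (2 * n + 1))"
    by (auto simp: sin_coeff_def scaleR_conv_of_real mult.commute)
  finally show ?thesis .
qed

text \<open>
  In this series only powers of \<open>lam\<close> itself occur, so the branch cut of \<open>csqrt\<close> leaves no trace.
\<close>

lemma s_fun_sums:
  "(\<lambda>k. (- lam) ^ k * of_real (x ^ (2 * k + 1) / fact (2 * k + 1))) sums s_fun (csqrt lam) x"
proof (cases "lam = 0")
  case True
  then have "(\<lambda>k. (- lam) ^ k * complex_of_real (x ^ (2 * k + 1) / fact (2 * k + 1)))
      = (\<lambda>k. if k = 0 then of_real x else 0)"
    by (auto simp: fun_eq_iff power_0_left)
  then show ?thesis
    using True sums_single[of 0 "\<lambda>_. complex_of_real x"] by (simp add: s_fun_def)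
next
  case False
  define \<rho> where "\<rho> = csqrt lam"
  have \<rho>: "\<rho> \<noteq> 0" "lam = \<rho>\<^sup>2" using False by (auto simp: \<rho>_def)
  have "(\<lambda>k. (- 1) ^ k / fact (2 * k + 1) * (\<rho> * of_real x) ^ (2 * k + 1) / \<rho>)
      sums (sin (\<rho> * of_real x) / \<rho>)"
    by (rule sums_divide[OF sin_paired_complex])
  also have "(\<lambda>k. (- 1) ^ k / fact (2 * k + 1) * (\<rho> * of_real x) ^ (2 * k + 1) / \<rho>)
     = (\<lambda>k. (- lam) ^ k * of_real (x ^ (2 * k + 1) / fact (2 * k + 1)))"
  proof
    fix k
    have "(\<rho> * complex_of_real x) ^ (2 * k + 1) = \<rho> * (lam ^ k * of_real x ^ (2 * k + 1))"
      by (simp add: \<rho>(2) power_mult power_mult_distrib)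
    then show "(- 1) ^ k / fact (2 * k + 1) * (\<rho> * complex_of_real x) ^ (2 * k + 1) / \<rho>
        = (- lam) ^ k * of_real (x ^ (2 * k + 1) / fact (2 * k + 1))"
      using \<rho>(1) by (simp add: power_minus[of lam])
  qed
  finally show ?thesis using \<rho>(1) by (simp add: s_fun_def flip: \<rho>_def)
qed

lemma holomorphic_power_series_UNIV:
  fixes f :: "complex \<Rightarrow> complex"
  assumes "\<And>z. (\<lambda>n. c n * z ^ n) sums f z"
  shows "f holomorphic_on UNIV"
proof -
  have "f holomorphic_on ball 0 (norm z + 1)" for z
    using assms by (intro power_series_holomorphic[where a = c]) auto
  then have "f field_differentiable at z" for z
    by (rule holomorphic_on_imp_differentiable_at[where s = "ball 0 (norm z + 1)"]) auto
  then show ?thesis by (simp add: holomorphic_on_def field_differentiable_at_within)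
qed

lemma holomorphic_s_fun: "(\<lambda>lam. s_fun (csqrt lam) x) holomorphic_on UNIV"
proof (rule holomorphic_power_series_UNIV)
  show "(\<lambda>k. ((- 1) ^ k * of_real (x ^ (2 * k + 1) / fact (2 * k + 1))) * lam ^ k)
      sums s_fun (csqrt lam) x" for lam
    using s_fun_sums[of lam x] by (simp add: power_minus[of lam] mult_ac)
qed

lemma continuous_s_fun [continuous_intros]:
  fixes f :: "real \<Rightarrow> real"
  shows "continuous_on A f \<Longrightarrow> continuous_on A (\<lambda>x. s_fun \<rho> (f x))"
  by (cases "\<rho> = 0") (auto simp: s_fun_def intro!: continuous_intros)

text \<open>
  Integrating the power series of \<open>s\<close> term by term gives a power series in \<open>lam\<close> that converges
  everywhere.
\<close>

lemma holomorphic_I_fun: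
  assumes q: "set_integrable lebesgue {0..pi} q" and x: "x \<le> pi"
  shows "(\<lambda>lam. I_fun q (csqrt lam) x) holomorphic_on UNIV"
proof (cases "0 \<le> x")
  case False
  then show ?thesis by (simp add: I_fun_def set_lebesgue_integral_def)
next
  case x0: True
  define c where "c k t = complex_of_real ((x - t) ^ (2 * k + 1) / fact (2 * k + 1))" for k t
  \<comment> \<open>\<open>norm (q t) * b lam k\<close> dominates the \<open>k\<close>-th term of the series of the integrand.\<close>
  define b where "b lam k = norm (lam :: complex) ^ k * (x ^ (2 * k + 1) / fact (2 * k + 1))" for lam k
  have q': "set_integrable lebesgue {0..x} q"
    by (rule set_integrable_subset[OF q]) (use x in auto)
  have int: "set_integrable lebesgue {0..x} (\<lambda>t. q t * (lam ^ k * c k t))" for lam k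
    unfolding c_def by (intro set_integrable_mult_continuous[OF q'] continuous_intros) auto
  have b_summable: "summable (b lam)" for lam
  proof (rule summable_comparison_test')
    show "summable (\<lambda>k. x * (inverse (fact k) * (norm lam * x\<^sup>2) ^ k))"
      by (intro summable_mult summable_exp)
    show "norm (b lam k) \<le> x * (inverse (fact k) * (norm lam * x\<^sup>2) ^ k)" for k
    proof -
      have "norm (b lam k) = x * (inverse (fact (2 * k + 1)) * (norm lam * x\<^sup>2) ^ k)"
        using x0 by (simp add: b_def power_mult_distrib divide_inverse mult_ac flip: power_mult)
      also have "\<dots> \<le> x * (inverse (fact k) * (norm lam * x\<^sup>2) ^ k)"
        using x0 by (intro mult_left_mono mult_right_mono le_imp_inverse_le fact_mono) auto
      finally show ?thesis .
    qed
  qed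
  have c_le: "norm (lam ^ k * c k t) \<le> b lam k" if "t \<in> {0..x}" for lam k t
  proof -
    have "norm (c k t) = \<bar>x - t\<bar> ^ (2 * k + 1) / fact (2 * k + 1)"
      unfolding c_def norm_of_real by (simp only: abs_divide power_abs abs_of_nonneg[OF fact_ge_zero])
    also have "\<dots> \<le> x ^ (2 * k + 1) / fact (2 * k + 1)"
      using that by (intro divide_right_mono power_mono) auto
    finally show ?thesis
      unfolding b_def norm_mult norm_power by (intro mult_left_mono) auto
  qed
  show ?thesis
  proof (rule holomorphic_power_series_UNIV)
    fix lam :: complex
    let ?f = "\<lambda>k t. indicator {0..x} t *\<^sub>R (q t * ((- lam) ^ k * c k t))"
    have norm_f: "norm (?f k t) \<le> norm (indicator {0..x} t *\<^sub>R q t) * b lam k" for k t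
    proof (cases "t \<in> {0..x}")
      case True
      have "norm ((- lam) ^ k * c k t) \<le> b lam k"
        using c_le[OF True, of "- lam" k] by (simp only: b_def norm_minus_cancel)
      then have "norm (q t) * norm ((- lam) ^ k * c k t) \<le> norm (q t) * b lam k"
        by (intro mult_left_mono) auto
      then show ?thesis using True by (simp only: norm_scaleR norm_mult) simp
    qed simp
    have "(\<lambda>k. integral\<^sup>L lebesgue (?f k)) sums (LINT t|lebesgue. (\<Sum>k. ?f k t))"
    proof (rule sums_integral)
      show "integrable lebesgue (?f k)" for k
        using int[of "- lam" k] by (simp add: set_integrable_def)
      show "AE t in lebesgue. summable (\<lambda>k. norm (?f k t))"
        by (intro always_eventually allI summable_comparison_test'[OF summable_mult[OF b_summable[of lam]]])
           (use norm_f in auto)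
      show "summable (\<lambda>k. LINT t|lebesgue. norm (?f k t))"
      proof (rule summable_comparison_test'[OF summable_mult[OF b_summable[of lam]]])
        show "norm (LINT t|lebesgue. norm (?f k t))
            \<le> (LINT t|lebesgue. norm (indicator {0..x} t *\<^sub>R q t)) * b lam k" for k
        proof -
          have "(LINT t|lebesgue. norm (?f k t))
            \<le> (LINT t|lebesgue. norm (indicator {0..x} t *\<^sub>R q t) * b lam k)"
          proof (rule integral_mono)
            show "integrable lebesgue (\<lambda>t. norm (?f k t))"
              using int[of "- lam" k] unfolding set_integrable_def by (rule integrable_norm)
            show "integrable lebesgue (\<lambda>t. norm (indicator {0..x} t *\<^sub>R q t) * b lam k)"
              using q' unfolding set_integrable_def by (intro integrable_mult_left integrable_norm)
          qed (rule norm_f)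
          then show ?thesis by simp
        qed
      qed
    qed
    also have "(\<lambda>t. \<Sum>k. ?f k t) = (\<lambda>t. indicator {0..x} t *\<^sub>R (q t * s_fun (csqrt lam) (x - t)))"
    proof
      fix t
      have "(\<lambda>k. ?f k t) sums (indicator {0..x} t *\<^sub>R (q t * s_fun (csqrt lam) (x - t)))"
        unfolding c_def by (intro sums_scaleR_right sums_mult s_fun_sums)
      then show "(\<Sum>k. ?f k t) = indicator {0..x} t *\<^sub>R (q t * s_fun (csqrt lam) (x - t))"
        by (simp add: sums_iff)
    qed
    also have "(\<lambda>k. integral\<^sup>L lebesgue (?f k))
        = (\<lambda>k. ((- 1) ^ k * (LINT t:{0..x}|lebesgue. q t * c k t)) * lam ^ k)"
    proof
      fix k
      have "integral\<^sup>L lebesgue (?f k)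
          = (LINT t|lebesgue. (- lam) ^ k * (indicator {0..x} t *\<^sub>R (q t * c k t)))"
        by (intro Bochner_Integration.integral_cong) (auto simp: indicator_def)
      also have "\<dots> = (- lam) ^ k * (LINT t:{0..x}|lebesgue. q t * c k t)"
        unfolding set_lebesgue_integral_def by (rule integral_mult_right_zero)
      finally show "integral\<^sup>L lebesgue (?f k)
        = ((- 1) ^ k * (LINT t:{0..x}|lebesgue. q t * c k t)) * lam ^ k"
        by (simp add: power_minus[of lam] mult_ac)
    qed
    finally show "(\<lambda>k. ((- 1) ^ k * (LINT t:{0..x}|lebesgue. q t * c k t)) * lam ^ k)
       sums I_fun q (csqrt lam) x"
      by (simp add: I_fun_def set_lebesgue_integral_def)
  qed
qed

section \<open>Zeros of the determinant are eigenvalues\<close>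

lemma LINT_singleton: "(LINT t:{a}|lebesgue. g t) = (0 :: complex)" for a :: real
proof -
  have "AE t in lebesgue. t \<noteq> a"
    by (rule AE_I'[of "{a}"]) auto
  then show ?thesis
    unfolding set_lebesgue_integral_def
    by (intro integral_eq_zero_AE) (auto elim!: eventually_mono)
qed

lemma has_vector_derivative_iff_quotient:
  fixes f :: "real \<Rightarrow> 'a :: real_normed_vector"
  shows "(f has_vector_derivative d) (at x within S)
     \<longleftrightarrow> ((\<lambda>y. (f y - f x) /\<^sub>R (y - x)) \<longlongrightarrow> d) (at x within S)"
proof -
  have "norm (f y - f x - (y - x) *\<^sub>R d) / norm (y - x) = norm ((f y - f x) /\<^sub>R (y - x) - d)"
    if "y \<noteq> x" for y
  proof -
    have "(f y - f x) /\<^sub>R (y - x) - d = (f y - f x - (y - x) *\<^sub>R d) /\<^sub>R (y - x)"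
      using that by (simp add: scaleR_right_diff_distrib)
    then show ?thesis by (simp add: divide_inverse mult.commute)
  qed
  then have "((\<lambda>y. norm (f y - f x - (y - x) *\<^sub>R d) / norm (y - x)) \<longlongrightarrow> 0) (at x within S)
     \<longleftrightarrow> ((\<lambda>y. norm ((f y - f x) /\<^sub>R (y - x) - d)) \<longlongrightarrow> 0) (at x within S)"
    by (intro Lim_cong_within) auto
  then show ?thesis
    unfolding has_vector_derivative_def has_derivative_iff_norm
    by (simp add: bounded_linear_scaleR_left tendsto_norm_zero_iff LIM_zero_iff)
qed

text \<open>
  Leibniz' rule for a convolution with a merely integrable \<open>q\<close>. The boundary term
  \<open>q x * k 0\<close>, which would make sense only almost everywhere, drops out because \<open>k 0 = 0\<close>; the
  derivative therefore exists at every point.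
\<close>

lemma convolution_has_vector_derivative:
  fixes q k k' :: "real \<Rightarrow> complex"
  assumes q: "set_integrable lebesgue {0..b} q"
    and k0: "k 0 = 0" and der: "\<And>u. (k has_vector_derivative k' u) (at u)"
    and k': "continuous_on UNIV k'" and x: "x \<in> {0..b}"
  shows "((\<lambda>x. LINT t:{0..x}|lebesgue. q t * k (x - t)) has_vector_derivative
      (LINT t:{0..x}|lebesgue. q t * k' (x - t))) (at x within {0..b})"
proof -
  \<comment> \<open>Extending \<open>k\<close> by 0 to the negative half line makes the domain of integration independent
    of \<open>x\<close>, so that only the integrand has to be differentiated.\<close>
  define F where "F t = indicator {0..b} t *\<^sub>R q t" for t
  define p where "p u = (if u \<ge> 0 then k u else 0)" for u :: real
  define p' where "p' u = (if u \<ge> 0 then k' u else 0)" for u :: real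
  have F: "integrable lebesgue F" using q unfolding F_def set_integrable_def .
  have conv: "(LINT t:{0..y}|lebesgue. q t * g (y - t))
      = (LINT t|lebesgue. F t * (if y - t \<ge> 0 then g (y - t) else 0))" if "y \<in> {0..b}" for y g
    unfolding set_lebesgue_integral_def F_def using that
    by (intro Bochner_Integration.integral_cong) (auto simp: indicator_def)
  have kc: "continuous_on S k" for S
    using der by (meson continuous_at_imp_continuous_on has_vector_derivative_continuous)
  have int: "integrable lebesgue (\<lambda>t. F t * (if y - t \<ge> 0 then g (y - t) else 0))"
    if y: "y \<in> {0..b}" and g: "continuous_on UNIV g" for y g
  proof -
    have "set_integrable lebesgue {0..y} q"
      by (rule set_integrable_subset[OF q]) (use y in auto)
    then have "set_integrable lebesgue {0..y} (\<lambda>t. q t * g (y - t))"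
      by (rule set_integrable_mult_continuous)
         (intro continuous_on_compose2[OF g] continuous_intros, auto)
    moreover have "(\<lambda>t. F t * (if y - t \<ge> 0 then g (y - t) else 0))
        = (\<lambda>t. indicator {0..y} t *\<^sub>R (q t * g (y - t)))"
      using y by (auto simp: fun_eq_iff F_def indicator_def)
    ultimately show ?thesis unfolding set_integrable_def by simp
  qed
  note int_p = int[where g = k, OF _ kc, folded p_def]
  have "compact (k' ` {-b..b})"
    by (intro compact_continuous_image continuous_on_subset[OF k']) auto
  then obtain B where B: "B \<ge> 0" "\<And>u. u \<in> {-b..b} \<Longrightarrow> norm (k' u) \<le> B"
    by (metis (no_types, lifting) bounded_pos compact_imp_bounded imageI less_imp_le)
  have k_lip: "norm (k u - k v) \<le> B * \<bar>u - v\<bar>" if "u \<in> {-b..b}" "v \<in> {-b..b}" for u v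
  proof -
    have "norm (k u - k v) \<le> B * norm (u - v)"
    proof (rule differentiable_bound[where f' = "\<lambda>w h. h *\<^sub>R k' w" and S = "{-b..b}"])
      show "(k has_derivative (\<lambda>h. h *\<^sub>R k' w)) (at w within {-b..b})" for w
        using der[of w] by (simp add: has_vector_derivative_def has_derivative_at_withinI)
      show "onorm (\<lambda>h. h *\<^sub>R k' w) \<le> B" if "w \<in> {-b..b}" for w
      proof (rule onorm_bound[OF B(1)])
        show "norm (h *\<^sub>R k' w) \<le> B * norm h" for h
          using mult_left_mono[OF B(2)[OF that], of "\<bar>h\<bar>"] by (simp add: mult.commute)
      qed
    qed (use that in auto)
    then show ?thesis by simp
  qed
  \<comment> \<open>Gluing \<open>k\<close> to 0 at the origin keeps the Lipschitz constant because \<open>k 0 = 0\<close>.\<close>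
  have p_lip: "norm (p u - p v) \<le> B * \<bar>u - v\<bar>" if "u \<in> {-b..b}" "v \<in> {-b..b}" for u v
  proof -
    have "norm (k u) \<le> B * \<bar>u - v\<bar>" if "0 \<le> u" "v < 0" "u \<in> {-b..b}" for u v
    proof -
      have "norm (k u) \<le> B * \<bar>u\<bar>" using k_lip[of u 0] that k0 by auto
      also have "\<dots> \<le> B * \<bar>u - v\<bar>" using that B(1) by (intro mult_left_mono) auto
      finally show ?thesis .
    qed
    from this[of u v] this[of v u] show ?thesis
      using k_lip[OF that] that mult_nonneg_nonneg[OF B(1) abs_ge_zero[of "u - v"]] by (auto simp: p_def norm_minus_commute abs_minus_commute)
  qed
  have p_der: "(p has_vector_derivative p' u) (at u)" if "u \<noteq> 0" for u
  proof (cases "u > 0")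
    case True
    then show ?thesis
      by (intro has_vector_derivative_transform_within_open[OF der open_greaterThan[of 0], of u p,
            THEN has_vector_derivative_eq_rhs]) (auto simp: p_def p'_def)
  next
    case False
    then show ?thesis using that
      by (intro has_vector_derivative_transform_within_open[OF has_vector_derivative_const
            open_lessThan[of 0], of u 0 p, THEN has_vector_derivative_eq_rhs])
         (auto simp: p_def p'_def)
  qed
  show ?thesis
    unfolding has_vector_derivative_iff_quotient tendsto_at_iff_sequentially
  proof (rule allI, rule impI, rule impI)
    fix X assume X: "\<forall>i. X i \<in> {0..b} - {x}" and lim: "X \<longlonglongrightarrow> x"
    have Xi: "X i \<in> {0..b}" "X i \<noteq> x" for i using X by auto
    let ?D = "\<lambda>i t. F t * ((p (X i - t) - p (x - t)) /\<^sub>R (X i - x))"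
    have "(\<lambda>i. integral\<^sup>L lebesgue (?D i)) \<longlonglongrightarrow> (LINT t|lebesgue. F t * p' (x - t))"
    proof (rule integral_dominated_convergence[where w = "\<lambda>t. norm (F t) * B"])
      show "integrable lebesgue (\<lambda>t. norm (F t) * B)"
        by (intro integrable_mult_left integrable_norm F)
      show "?D i \<in> borel_measurable lebesgue" for i
        unfolding mult_scaleR_right right_diff_distrib
        by (intro borel_measurable_scaleR borel_measurable_const borel_measurable_diff
            borel_measurable_integrable int_p x Xi)
      show "(\<lambda>t. F t * p' (x - t)) \<in> borel_measurable lebesgue"
        unfolding p'_def by (intro borel_measurable_integrable int x k')
      show "AE t in lebesgue. norm (?D i t) \<le> norm (F t) * B" for i
      proof (intro always_eventually allI)
        fix t
        show "norm (?D i t) \<le> norm (F t) * B"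
        proof (cases "t \<in> {0..b}")
          case True
          have "norm (p (X i - t) - p (x - t)) \<le> B * \<bar>X i - x\<bar>"
            using p_lip[of "X i - t" "x - t"] True x Xi(1)[of i] by auto
          then have "norm (p (X i - t) - p (x - t)) / \<bar>X i - x\<bar> \<le> B"
            using Xi(2)[of i] by (simp add: pos_divide_le_eq)
          moreover have "norm ((p (X i - t) - p (x - t)) /\<^sub>R (X i - x))
              = norm (p (X i - t) - p (x - t)) / \<bar>X i - x\<bar>"
            unfolding norm_scaleR by (simp add: divide_inverse mult.commute)
          ultimately have "norm ((p (X i - t) - p (x - t)) /\<^sub>R (X i - x)) \<le> B" by simp
          then show ?thesis unfolding norm_mult by (intro mult_left_mono) auto
        qed (auto simp: F_def)
      qed
      have "AE t in lebesgue. t \<noteq> x"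
        by (rule AE_I'[of "{x}"]) auto
      then show "AE t in lebesgue. (\<lambda>i. ?D i t) \<longlonglongrightarrow> F t * p' (x - t)"
      proof eventually_elim
        case (elim t)
        then have "((\<lambda>y. (p y - p (x - t)) /\<^sub>R (y - (x - t))) \<longlongrightarrow> p' (x - t)) (at (x - t))"
          using p_der[of "x - t"] by (simp add: has_vector_derivative_iff_quotient)
        moreover have "filterlim (\<lambda>i. X i - t) (at (x - t)) sequentially"
          by (intro filterlim_atI tendsto_intros lim) (use Xi(2) in auto)
        ultimately have "(\<lambda>i. (p (X i - t) - p (x - t)) /\<^sub>R ((X i - t) - (x - t))) \<longlonglongrightarrow> p' (x - t)"
          by (rule filterlim_compose)
        then show ?case by (intro tendsto_mult_left) simp
      qed
    qed
    moreover have "integral\<^sup>L lebesgue (?D i)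
        = ((LINT t:{0..X i}|lebesgue. q t * k (X i - t)) - (LINT t:{0..x}|lebesgue. q t * k (x - t)))
           /\<^sub>R (X i - x)" for i
    proof -
      have "integral\<^sup>L lebesgue (?D i)
          = (LINT t|lebesgue. (F t * p (X i - t) - F t * p (x - t)) /\<^sub>R (X i - x))"
        by (simp only: mult_scaleR_right right_diff_distrib)
      also have "\<dots> = ((LINT t|lebesgue. F t * p (X i - t)) - (LINT t|lebesgue. F t * p (x - t)))
           /\<^sub>R (X i - x)"
        by (simp only: integral_scaleR_right Bochner_Integration.integral_diff[OF int_p[OF Xi(1)] int_p[OF x]])
      finally show ?thesis using conv[OF Xi(1)[of i], of k] conv[OF x, of k] by (simp only: p_def)
    qed
    moreover have "(LINT t|lebesgue. F t * p' (x - t)) = (LINT t:{0..x}|lebesgue. q t * k' (x - t))"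
      using conv[OF x, of k'] by (simp only: p'_def)
    ultimately show "((\<lambda>y. ((LINT t:{0..y}|lebesgue. q t * k (y - t))
        - (LINT t:{0..x}|lebesgue. q t * k (x - t))) /\<^sub>R (y - x)) \<circ> X)
        \<longlonglongrightarrow> (LINT t:{0..x}|lebesgue. q t * k' (x - t))"
      by (simp only: o_def)
  qed
qed

lemma s_fun_has_vector_derivative:
  "((\<lambda>x. s_fun \<rho> x) has_vector_derivative cos (\<rho> * of_real x)) (at x within S)"
proof (cases "\<rho> = 0")
  case True
  then show ?thesis
    by (auto simp: s_fun_def intro!: has_vector_derivative_real_field derivative_eq_intros)
next
  case False
  have "((\<lambda>z. sin (\<rho> * z) / \<rho>) has_field_derivative cos (\<rho> * of_real x)) (at (of_real x))"
    using False by (auto intro!: derivative_eq_intros)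
  from has_vector_derivative_real_field[OF this] show ?thesis
    using False by (simp add: s_fun_def)
qed

lemma cos_has_vector_derivative_s_fun:
  "((\<lambda>x. cos (\<rho> * of_real x)) has_vector_derivative - (\<rho>\<^sup>2) * s_fun \<rho> x) (at x within S)"
proof -
  have "((\<lambda>z. cos (\<rho> * z)) has_field_derivative - (\<rho> * sin (\<rho> * of_real x))) (at (of_real x))"
    by (auto intro!: derivative_eq_intros)
  then have "((\<lambda>x. cos (\<rho> * of_real x)) has_vector_derivative - (\<rho> * sin (\<rho> * of_real x)))
      (at x within S)"
    by (rule has_vector_derivative_real_field)
  also have "- (\<rho> * sin (\<rho> * of_real x)) = - (\<rho>\<^sup>2) * s_fun \<rho> x"
    by (simp add: s_fun_def power2_eq_square)
  finally show ?thesis .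
qed

text \<open>
  The positive zeros of \<open>s\<close> are at least \<open>\<pi> / norm \<rho>\<close>, so a small positive \<open>x\<close> is not a zero.
\<close>

lemma s_fun_not_identically_zero: "\<exists>x\<in>{0..pi}. s_fun \<rho> x \<noteq> 0"
proof (cases "\<rho> = 0")
  case True
  then show ?thesis by (intro bexI[of _ pi]) (auto simp: s_fun_def)
next
  case False
  define x where "x = 1 / (norm \<rho> + 1)"
  have pos: "norm \<rho> + 1 > 0" using norm_ge_zero[of \<rho>] by linarith
  have x: "0 < x" "x \<le> 1" using pos by (simp_all add: x_def)
  have "sin (\<rho> * of_real x) \<noteq> 0"
  proof
    assume "sin (\<rho> * of_real x) = 0"
    then obtain m :: int where m: "\<rho> * of_real x = of_real (of_int m * pi)"
      unfolding sin_eq_0 by auto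
    have "norm (\<rho> * of_real x) < 1"
      using pos by (simp add: norm_mult x_def norm_divide)
    then have "\<bar>real_of_int m\<bar> * pi < 1" unfolding m norm_of_real by (simp add: abs_mult)
    moreover have "\<bar>real_of_int m\<bar> * pi \<ge> 1" if "m \<noteq> 0"
    proof -
      have "1 * 1 \<le> \<bar>real_of_int m\<bar> * pi"
        using that pi_gt3 by (intro mult_mono) auto
      then show ?thesis by simp
    qed
    ultimately have "m = 0" by force
    then show False using m False x by simp
  qed
  then show ?thesis
    using False x pi_gt3 by (intro bexI[of _ x]) (auto simp: s_fun_def)
qed

text \<open>
  Variation of constants: \<open>s\<close> solves the homogeneous equation and \<open>I\<close> the equation with right-hand
  side \<open>q\<close>. The second assumption says that the constant \<open>C\<close> in front of \<open>q\<close> is the sum of the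
  values of the solution at the frozen points, as the equation demands.
\<close>

lemma frozen_combination_solution:
  assumes q: "set_integrable lebesgue {0..pi} q"
    and bc: "A * s_fun \<rho> pi + C * I_fun q \<rho> pi = 0"
    and frozen: "(\<Sum>i=1..n. A * s_fun \<rho> (a i) + C * I_fun q \<rho> (a i)) = C"
  shows "bvp_solution n a q (\<rho>\<^sup>2) (\<lambda>x. A * s_fun \<rho> x + C * I_fun q \<rho> x)"
proof -
  let ?c = "\<lambda>x::real. cos (\<rho> * of_real x)"
  define y where "y x = A * s_fun \<rho> x + C * I_fun q \<rho> x" for x
  \<comment> \<open>The kernel \<open>cos\<close> of \<open>J\<close>, the derivative of \<open>I\<close>, does not vanish at 0. Splitting it as
    \<open>(cos - 1) + 1\<close> separates a continuously differentiable part \<open>W\<close> from the indefinite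
    integral \<open>Q\<close> of \<open>q\<close>, which is only absolutely continuous.\<close>
  define W where "W x = (LINT t:{0..x}|lebesgue. q t * (?c (x - t) - 1))" for x
  define Q where "Q x = (LINT t:{0..x}|lebesgue. q t)" for x
  define J where "J x = (LINT t:{0..x}|lebesgue. q t * ?c (x - t))" for x
  define y1 where "y1 x = A * ?c x + C * J x" for x
  define y2 where "y2 x = - (\<rho>\<^sup>2) * y x + C * q x" for x
  have q': "set_integrable lebesgue {0..x} q" if "x \<in> {0..pi}" for x
    by (rule set_integrable_subset[OF q]) (use that in auto)
  have J: "J x = W x + Q x" if x: "x \<in> {0..pi}" for x
  proof -
    have "set_integrable lebesgue {0..x} (\<lambda>t. q t * (?c (x - t) - 1))"
      by (intro set_integrable_mult_continuous[OF q'[OF x]] continuous_intros)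
    from set_integral_add(2)[OF this q'[OF x]] show ?thesis
      by (simp add: J_def W_def Q_def algebra_simps)
  qed
  have dI: "(I_fun q \<rho> has_vector_derivative J x) (at x within {0..pi})" if "x \<in> {0..pi}" for x
    unfolding I_fun_def[abs_def] J_def
    by (rule convolution_has_vector_derivative[OF q _ s_fun_has_vector_derivative _ that])
       (auto simp: s_fun_def intro!: continuous_intros)
  have dW: "(W has_vector_derivative - (\<rho>\<^sup>2) * I_fun q \<rho> x) (at x within {0..pi})"
    if "x \<in> {0..pi}" for x
  proof -
    have "((\<lambda>u. ?c u - 1) has_vector_derivative - (\<rho>\<^sup>2) * s_fun \<rho> u) (at u)" for u
      using has_vector_derivative_diff[OF cos_has_vector_derivative_s_fun has_vector_derivative_const]
      by simp
    then have "(W has_vector_derivative (LINT t:{0..x}|lebesgue. q t * (- (\<rho>\<^sup>2) * s_fun \<rho> (x - t))))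
        (at x within {0..pi})"
      unfolding W_def[abs_def]
      by (intro convolution_has_vector_derivative[OF q _ _ _ that]) (auto intro!: continuous_intros)
    also have "(LINT t:{0..x}|lebesgue. q t * (- (\<rho>\<^sup>2) * s_fun \<rho> (x - t))) = - (\<rho>\<^sup>2) * I_fun q \<rho> x"
      unfolding I_fun_def
      by (subst set_integral_mult_right[symmetric]) (simp add: mult_ac)
    finally show ?thesis .
  qed
  have dy: "(y has_vector_derivative y1 x) (at x within {0..pi})" if "x \<in> {0..pi}" for x
    unfolding y_def[abs_def] y1_def
    by (intro has_vector_derivative_add has_vector_derivative_mult_right
        s_fun_has_vector_derivative dI that)
  have y_cont: "continuous_on {0..pi} y"
    unfolding continuous_on_eq_continuous_within
    by (intro ballI has_vector_derivative_continuous[OF dy])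
  have y_int: "set_integrable lebesgue {0..x} (\<lambda>t. - (\<rho>\<^sup>2) * y t)" if "x \<in> {0..pi}" for x
    using that by (intro absolutely_integrable_continuous_real continuous_intros
        continuous_on_subset[OF y_cont]) auto
  have Cq_int: "set_integrable lebesgue {0..x} (\<lambda>t. C * q t)" if "x \<in> {0..pi}" for x
    using q'[OF that] by simp
  have y1_eq: "y1 x = y1 0 + (LINT t:{0..x}|lebesgue. y2 t)" if x: "x \<in> {0..pi}" for x
  proof -
    have "((\<lambda>u. - (\<rho>\<^sup>2) * y u) has_integral (A * ?c x + C * W x) - (A * ?c 0 + C * W 0)) {0..x}"
    proof (rule fundamental_theorem_of_calculus)
      show "((\<lambda>u. A * ?c u + C * W u) has_vector_derivative - (\<rho>\<^sup>2) * y u) (at u within {0..x})"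
        if u: "u \<in> {0..x}" for u
      proof -
        have "((\<lambda>u. A * ?c u + C * W u) has_vector_derivative
            A * (- (\<rho>\<^sup>2) * s_fun \<rho> u) + C * (- (\<rho>\<^sup>2) * I_fun q \<rho> u)) (at u within {0..x})"
          using u x
          by (intro has_vector_derivative_add has_vector_derivative_mult_right
              cos_has_vector_derivative_s_fun has_vector_derivative_within_subset[OF dW]) auto
        then show ?thesis by (simp add: y_def algebra_simps)
      qed
    qed (use x in auto)
    then have "(LINT t:{0..x}|lebesgue. - (\<rho>\<^sup>2) * y t) = (A * ?c x + C * W x) - (A * ?c 0 + C * W 0)"
      by (rule trans[OF set_lebesgue_integral_eq_integral(2)[OF y_int[OF x]] integral_unique])
    moreover have "(LINT t:{0..x}|lebesgue. y2 t)
        = (LINT t:{0..x}|lebesgue. - (\<rho>\<^sup>2) * y t) + C * Q x"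
      unfolding y2_def Q_def
      by (simp only: set_integral_add(2)[OF y_int[OF x] Cq_int[OF x]] set_integral_mult_right)
    moreover have "W 0 = 0" "J 0 = 0" by (simp_all add: W_def J_def LINT_singleton)
    ultimately show ?thesis using J[OF x] by (simp add: y1_def algebra_simps)
  qed
  have y2_int: "y2 absolutely_integrable_on {0..pi}"
    unfolding y2_def using set_integral_add(1)[OF y_int[of pi] Cq_int[of pi]] by simp
  have y0: "y 0 = 0" by (simp add: y_def s_fun_def I_fun_def LINT_singleton)
  have "- y2 x + q x * (\<Sum>i=1..n. y (a i)) = \<rho>\<^sup>2 * y x" for x
    using frozen by (simp add: y2_def y_def)
  moreover have "y pi = 0" using bc by (simp add: y_def)
  ultimately have "bvp_solution n a q (\<rho>\<^sup>2) y"
    unfolding bvp_solution_def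
    by (intro conjI exI[of _ y1] exI[of _ y2] ballI always_eventually allI dy y2_int y1_eq y0)
  then show ?thesis by (simp add: y_def[abs_def])
qed

text \<open>
  The two conditions on the coefficients in \<open>frozen_combination_solution\<close> form a homogeneous linear
  system of size 2, whose determinant is the characteristic function up to sign.
\<close>

lemma char_fun_zero_imp_eigenvalue:
  assumes n: "n \<ge> 1" and a: "frozen_points n a" and q: "set_integrable lebesgue {0..pi} q"
    and zero: "char_fun n a q lam = 0"
  shows "bvp_eigenvalue n a q lam"
proof -
  define \<rho> where "\<rho> = csqrt lam"
  have lam: "lam = \<rho>\<^sup>2" by (simp add: \<rho>_def)
  let ?s = "s_fun \<rho>" and ?I = "I_fun q \<rho>"
  define \<sigma> \<tau> where "\<sigma> = (\<Sum>i=1..n. ?s (a i))" and "\<tau> = (\<Sum>i=1..n. ?I (a i))"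
  have det: "?s pi * (1 - \<tau>) + \<sigma> * ?I pi = 0"
    using zero by (simp add: char_fun_csqrt[OF n] frozen_char_def \<sigma>_def \<tau>_def \<rho>_def
        sum_subtractf sum_distrib_left sum_distrib_right algebra_simps)
  \<comment> \<open>By \<open>det\<close> the homogeneous system for \<open>(A, C)\<close> is singular.\<close>
  have "\<exists>A C. (A, C) \<noteq> (0, 0) \<and> A * ?s pi + C * ?I pi = 0 \<and> A * \<sigma> + C * \<tau> = C"
  proof (cases "?s pi = 0 \<and> ?I pi = 0")
    case False
    then show ?thesis
      using det by (intro exI[of _ "- ?I pi"] exI[of _ "?s pi"]) (auto simp: algebra_simps)
  next
    case True
    then show ?thesis
    proof (cases "\<sigma> = 0 \<and> \<tau> = 1")
      case False
      then show ?thesis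
        using True by (intro exI[of _ "1 - \<tau>"] exI[of _ "\<sigma>"]) (auto simp: algebra_simps)
    qed (auto intro!: exI[of _ 1])
  qed
  then obtain A C where nz: "(A, C) \<noteq> (0, 0)" and bc: "A * ?s pi + C * ?I pi = 0"
    and fr: "A * \<sigma> + C * \<tau> = C" by blast
  have fr': "(\<Sum>i=1..n. A * ?s (a i) + C * ?I (a i)) = C"
    using fr by (simp add: \<sigma>_def \<tau>_def sum.distrib sum_distrib_left)
  have "\<exists>x\<in>{0..pi}. A * ?s x + C * ?I x \<noteq> 0"
  proof (rule ccontr)
    assume "\<not> ?thesis"
    then have all: "A * ?s x + C * ?I x = 0" if "x \<in> {0..pi}" for x using that by blast
    \<comment> \<open>\<open>C\<close> is the sum of the values of the solution at the frozen points; if they all vanish,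
      only the multiple \<open>A\<close> of \<open>s\<close> is left.\<close>
    have "(\<Sum>i=1..n. A * ?s (a i) + C * ?I (a i)) = 0"
      using frozen_points_bounds[OF a] by (intro sum.neutral ballI all) auto
    then have "C = 0" using fr' by simp
    then show False using all nz s_fun_not_identically_zero[of \<rho>] by auto
  qed
  then show ?thesis
    unfolding bvp_eigenvalue_def lam using frozen_combination_solution[OF q bc fr'] by blast
qed

section \<open>Asymptotics on large squares\<close>

lemma norm_sin_le: "norm (sin (z::complex)) \<le> exp \<bar>Im z\<bar>"
proof -
  have "norm (sin z) = norm (exp (\<i> * z) - exp (- (\<i> * z))) / 2"
    by (simp add: sin_exp_eq norm_divide norm_mult)
  also have "\<dots> \<le> (norm (exp (\<i> * z)) + norm (exp (- (\<i> * z)))) / 2"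
    by (intro divide_right_mono norm_triangle_ineq4) auto
  also have "\<dots> = (exp (- Im z) + exp (Im z)) / 2" by simp
  also have "\<dots> \<le> (exp \<bar>Im z\<bar> + exp \<bar>Im z\<bar>) / 2" by (intro divide_right_mono add_mono) auto
  finally show ?thesis by simp
qed

lemma norm_s_fun_le:
  assumes "\<rho> \<noteq> 0" "x \<ge> 0"
  shows "norm (s_fun \<rho> x) \<le> exp (\<bar>Im \<rho>\<bar> * x) / norm \<rho>"
  using assms norm_sin_le[of "\<rho> * of_real x"]
  by (auto simp: s_fun_def norm_divide abs_mult intro!: divide_right_mono)

text \<open>
  With \<open>b = \<pi>\<close> the left-hand side is the kernel of Green type for \<open>t \<le> a\<close>. Each of its products grows with exponent \<open>a + b - t\<close>, but the difference only with exponent \<open>b - a + t\<close>.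
\<close>

lemma s_fun_cross:
  "s_fun \<rho> a * s_fun \<rho> (b - t) - s_fun \<rho> b * s_fun \<rho> (a - t) = s_fun \<rho> t * s_fun \<rho> (b - a)"
proof (cases "\<rho> = 0")
  case False
  define A B T where "A = \<rho> * of_real a" "B = \<rho> * of_real b" "T = \<rho> * of_real t"
  have "sin A * sin (B - T) - sin B * sin (A - T) = sin T * sin (B - A)"
    by (simp add: sin_diff algebra_simps)
  then show ?thesis
    using False by (simp add: s_fun_def A_B_T_def field_simps)
qed (simp add: s_fun_def algebra_simps)

text \<open>
  In both cases the kernel is a product \<open>s(u) s(v)\<close> with \<open>u + v \<le> \<pi>\<close>: for \<open>t \<le> x\<close> this is the
  cancellation in \<open>s_fun_cross\<close>.
\<close>

lemma green_kernel_bound: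
  assumes \<rho>: "\<rho> \<noteq> 0" and x: "0 \<le> x" "x \<le> pi" and t: "0 \<le> t" "t \<le> pi"
  shows "norm (s_fun \<rho> x * s_fun \<rho> (pi - t) - (if t \<le> x then s_fun \<rho> pi * s_fun \<rho> (x - t) else 0))
     \<le> exp (pi * \<bar>Im \<rho>\<bar>) / (norm \<rho>)\<^sup>2"
proof -
  have bound: "norm (s_fun \<rho> u * s_fun \<rho> v) \<le> exp (pi * \<bar>Im \<rho>\<bar>) / (norm \<rho>)\<^sup>2"
    if "0 \<le> u" "0 \<le> v" "u + v \<le> pi" for u v
  proof -
    have "norm (s_fun \<rho> u * s_fun \<rho> v)
        \<le> (exp (\<bar>Im \<rho>\<bar> * u) / norm \<rho>) * (exp (\<bar>Im \<rho>\<bar> * v) / norm \<rho>)"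
      unfolding norm_mult using that \<rho> by (intro mult_mono norm_s_fun_le) auto
    also have "\<dots> = exp (\<bar>Im \<rho>\<bar> * (u + v)) / (norm \<rho>)\<^sup>2"
      by (simp add: power2_eq_square exp_add distrib_left)
    also have "\<dots> \<le> exp (pi * \<bar>Im \<rho>\<bar>) / (norm \<rho>)\<^sup>2"
      using mult_left_mono[OF that(3), of "\<bar>Im \<rho>\<bar>"]
      by (intro divide_right_mono) (auto simp: mult.commute)
    finally show ?thesis .
  qed
  show ?thesis
  proof (cases "t \<le> x")
    case True
    then show ?thesis
      using bound[of t "pi - x"] x t by (simp add: s_fun_cross)
  next
    case False
    then show ?thesis using bound[of x "pi - t"] x t by simp
  qed
qed

lemma green_term_bound:
  assumes q: "set_integrable lebesgue {0..pi} q" and \<rho>: "\<rho> \<noteq> 0" and x: "0 \<le> x" "x \<le> pi"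
  shows "norm (s_fun \<rho> x * I_fun q \<rho> pi - s_fun \<rho> pi * I_fun q \<rho> x)
     \<le> (LINT t:{0..pi}|lebesgue. norm (q t)) * (exp (pi * \<bar>Im \<rho>\<bar>) / (norm \<rho>)\<^sup>2)"
proof -
  let ?g = "\<lambda>y t. indicator {0..y} t *\<^sub>R (q t * s_fun \<rho> (y - t))"
  let ?k = "\<lambda>t. s_fun \<rho> x * ?g pi t - s_fun \<rho> pi * ?g x t"
  let ?B = "exp (pi * \<bar>Im \<rho>\<bar>) / (norm \<rho>)\<^sup>2"
  have int: "integrable lebesgue (?g y)" if "y \<le> pi" for y
  proof -
    have "set_integrable lebesgue {0..y} q"
      by (rule set_integrable_subset[OF q]) (use that in auto)
    then have "set_integrable lebesgue {0..y} (\<lambda>t. q t * s_fun \<rho> (y - t))"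
      by (rule set_integrable_mult_continuous) (intro continuous_intros)
    then show ?thesis by (simp add: set_integrable_def)
  qed
  have eq: "s_fun \<rho> x * I_fun q \<rho> pi - s_fun \<rho> pi * I_fun q \<rho> x = integral\<^sup>L lebesgue ?k"
    unfolding I_fun_def set_lebesgue_integral_def
    by (simp only: Bochner_Integration.integral_diff[OF integrable_mult_right[OF int[OF order_refl]]
          integrable_mult_right[OF int[OF x(2)]]] integral_mult_right_zero)
  have "norm (s_fun \<rho> x * I_fun q \<rho> pi - s_fun \<rho> pi * I_fun q \<rho> x) \<le> (LINT t|lebesgue. norm (?k t))"
    unfolding eq by (rule integral_norm_bound)
  also have "\<dots> \<le> (LINT t|lebesgue. norm (indicator {0..pi} t *\<^sub>R q t) * ?B)"
  proof (rule integral_mono)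
    show "integrable lebesgue (\<lambda>t. norm (?k t))"
      by (rule integrable_norm[OF Bochner_Integration.integrable_diff[OF
            integrable_mult_right[OF int[OF order_refl]] integrable_mult_right[OF int[OF x(2)]]]])
    show "integrable lebesgue (\<lambda>t. norm (indicator {0..pi} t *\<^sub>R q t) * ?B)"
      using q unfolding set_integrable_def by (rule integrable_mult_left[OF integrable_norm])
    show "norm (?k t) \<le> norm (indicator {0..pi} t *\<^sub>R q t) * ?B" for t
    proof (cases "t \<in> {0..pi}")
      case True
      have "?k t = q t * (s_fun \<rho> x * s_fun \<rho> (pi - t)
          - (if t \<le> x then s_fun \<rho> pi * s_fun \<rho> (x - t) else 0))"
        using True by (auto simp: indicator_def algebra_simps)
      then have "norm (?k t) = norm (q t) * norm (s_fun \<rho> x * s_fun \<rho> (pi - t)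
          - (if t \<le> x then s_fun \<rho> pi * s_fun \<rho> (x - t) else 0))"
        by (simp only: norm_mult)
      also have "\<dots> \<le> norm (q t) * ?B"
        using True by (intro mult_left_mono green_kernel_bound \<rho> x) auto
      finally show ?thesis using True by simp
    qed (use x in \<open>auto simp: indicator_def\<close>)
  qed
  also have "\<dots> = (LINT t:{0..pi}|lebesgue. norm (q t)) * ?B"
    by (simp add: set_lebesgue_integral_def)
  finally show ?thesis .
qed

text \<open>
  The leading term \<open>s(\<pi>)\<close> has order \<open>exp (\<pi> \<bar>Im \<rho>\<bar>) / norm \<rho>\<close> away from its zeros, so the potential
  contributes a correction smaller by a factor \<open>norm \<rho>\<close>.
\<close>

lemma frozen_char_asymptotics:
  assumes q: "set_integrable lebesgue {0..pi} q" and a: "frozen_points n a" and \<rho>: "\<rho> \<noteq> 0"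
  shows "norm (frozen_char n a q \<rho> - s_fun \<rho> pi)
     \<le> real n * (LINT t:{0..pi}|lebesgue. norm (q t)) * (exp (pi * \<bar>Im \<rho>\<bar>) / (norm \<rho>)\<^sup>2)"
proof -
  have "norm (frozen_char n a q \<rho> - s_fun \<rho> pi)
      \<le> (\<Sum>i=1..n. (LINT t:{0..pi}|lebesgue. norm (q t)) * (exp (pi * \<bar>Im \<rho>\<bar>) / (norm \<rho>)\<^sup>2))"
    unfolding frozen_char_def add_diff_cancel_left'
    by (rule order_trans[OF norm_sum], rule sum_mono)
       (intro green_term_bound q \<rho> frozen_points_bounds[OF a])
  then show ?thesis by simp
qed

text \<open>
  The boundary of the square with half side \<open>N + 1/2\<close> stays away from the integers, the zeros of
  \<open>sin (\<pi> \<rho>)\<close>; there the sine is as large as its exponential type permits, up to a constant.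
\<close>

lemma norm_sin_pi_square_ge:
  assumes R: "R = real N + 1/2" and \<rho>: "\<bar>Re \<rho>\<bar> = R \<or> \<bar>Im \<rho>\<bar> = R"
  shows "norm (sin (of_real pi * \<rho>)) \<ge> exp (pi * \<bar>Im \<rho>\<bar>) / 4"
proof -
  define u v where "u = pi * Re \<rho>" and "v = pi * Im \<rho>"
  have z: "of_real pi * \<rho> = Complex u v" by (simp add: u_def v_def complex_eq_iff)
  show ?thesis using \<rho>
  proof
    assume *: "\<bar>Re \<rho>\<bar> = R"
    \<comment> \<open>The vertical sides pass midway between consecutive zeros, where the sine of \<open>u\<close>
      has modulus 1.\<close>
    have "cos u = 0"
    proof -
      have "cos (pi * \<bar>Re \<rho>\<bar>) = cos (pi * real N + pi / 2)" by (simp add: * R algebra_simps)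
      also have "\<dots> = - sin (pi * real N)" by (simp add: cos_add)
      also have "\<dots> = 0" by (simp add: mult.commute)
      finally show ?thesis by (cases "Re \<rho> \<ge> 0") (auto simp: u_def)
    qed
    then have "(sin u)\<^sup>2 = 1" by (simp add: sin_squared_eq)
    then have "\<bar>sin u\<bar> = 1" by (auto simp: power2_eq_1_iff)
    have "exp \<bar>v\<bar> / 4 \<le> (exp v + exp (- v)) / 2"
      by (cases "v \<ge> 0") (auto simp: add_increasing add_increasing2)
    also have "\<dots> = \<bar>Re (sin (Complex u v))\<bar>"
      using \<open>\<bar>sin u\<bar> = 1\<close> by (simp add: Re_sin abs_mult exp_minus abs_of_pos add_pos_pos)
    also have "\<dots> \<le> norm (sin (Complex u v))" by (rule abs_Re_le_cmod)
    finally show ?thesis by (simp add: z v_def abs_mult)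
  next
    assume *: "\<bar>Im \<rho>\<bar> = R"
    have "exp \<bar>v\<bar> \<ge> 2"
    proof -
      have "\<bar>v\<bar> = pi * R" by (simp add: v_def abs_mult *)
      also have "\<dots> \<ge> 3 * (1/2)" using pi_gt3 by (intro mult_mono) (auto simp: R)
      finally show ?thesis using exp_ge_add_one_self[of "\<bar>v\<bar>"] by linarith
    qed
    moreover have "exp (- \<bar>v\<bar>) \<le> 1" by simp
    ultimately have "exp (- \<bar>v\<bar>) \<le> exp \<bar>v\<bar> / 2" by linarith
    then have "exp \<bar>v\<bar> / 4 \<le> (exp \<bar>v\<bar> - exp (- \<bar>v\<bar>)) / 2" by simp
    also have "\<dots> = \<bar>exp v - exp (- v)\<bar> / 2"
      by (cases "v \<ge> 0") auto
    also have "\<dots> \<le> norm (exp (\<i> * Complex u v) - exp (- (\<i> * Complex u v))) / 2"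
      using norm_triangle_ineq3[of "exp (\<i> * Complex u v)" "exp (- (\<i> * Complex u v))"] by simp
    also have "\<dots> = norm (sin (Complex u v))"
      by (simp add: sin_exp_eq norm_divide norm_mult)
    finally show ?thesis by (simp add: z v_def abs_mult)
  qed
qed

text \<open>
  On large squares both determinants are asymptotic to \<open>s(\<pi>)\<close>, whatever the potential, so their
  ratio tends to 1.
\<close>

lemma char_fun_ratio:
  assumes n: "n \<ge> 1" and a: "frozen_points n a"
    and q: "set_integrable lebesgue {0..pi} q" and qt: "set_integrable lebesgue {0..pi} qt"
  obtains M where "\<And>N \<rho>. \<bar>Re \<rho>\<bar> = real N + 1/2 \<or> \<bar>Im \<rho>\<bar> = real N + 1/2 \<Longrightarrow> real N \<ge> M \<Longrightarrow>
      char_fun n a qt (\<rho>\<^sup>2) \<noteq> 0 \<and>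
      norm (char_fun n a q (\<rho>\<^sup>2) / char_fun n a qt (\<rho>\<^sup>2) - 1) \<le> M / real N"
proof -
  define C where "C = real n * (LINT t:{0..pi}|lebesgue. norm (q t))
     + real n * (LINT t:{0..pi}|lebesgue. norm (qt t))"
  have nonneg: "0 \<le> real n * (LINT t:{0..pi}|lebesgue. norm (q t))" for q
    by (simp add: set_lebesgue_integral_def)
  have C0: "C \<ge> 0" unfolding C_def by (intro add_nonneg_nonneg nonneg)
  have *: "char_fun n a qt (\<rho>\<^sup>2) \<noteq> 0 \<and>
      norm (char_fun n a q (\<rho>\<^sup>2) / char_fun n a qt (\<rho>\<^sup>2) - 1) \<le> (8 * C + 1) / real N"
    if \<rho>: "\<bar>Re \<rho>\<bar> = real N + 1/2 \<or> \<bar>Im \<rho>\<bar> = real N + 1/2" and N: "real N \<ge> 8 * C + 1" for \<rho> N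
  proof -
    \<comment> \<open>On the square, \<open>s(\<pi>)\<close> has size at least \<open>E / 4\<close>, while both determinants differ from it
      by at most \<open>C * E / norm \<rho>\<close>, which is at most \<open>E / 8\<close> as soon as \<open>norm \<rho> \<ge> 8 * C\<close>.\<close>
    define E where "E = exp (pi * \<bar>Im \<rho>\<bar>) / norm \<rho>"
    have "norm \<rho> > real N" using \<rho> abs_Re_le_cmod[of \<rho>] abs_Im_le_cmod[of \<rho>] by linarith
    then have r: "norm \<rho> > real N" "\<rho> \<noteq> 0" "norm \<rho> \<ge> 8 * C" "norm \<rho> > 0" using N C0 by auto
    have E: "E > 0" using r by (simp add: E_def)
    have s: "norm (s_fun \<rho> pi) \<ge> E / 4"
      using norm_sin_pi_square_ge[OF refl \<rho>] r
      by (simp add: s_fun_def norm_divide E_def field_simps)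
    have dev: "norm (char_fun n a p (\<rho>\<^sup>2) - s_fun \<rho> pi)
        \<le> real n * (LINT t:{0..pi}|lebesgue. norm (p t)) * (E / norm \<rho>)"
      if "set_integrable lebesgue {0..pi} p" for p
    proof -
      have "E / norm \<rho> = exp (pi * \<bar>Im \<rho>\<bar>) / (norm \<rho>)\<^sup>2"
        by (simp add: E_def power2_eq_square)
      then show ?thesis
        unfolding char_fun_square[OF n] by (simp only: frozen_char_asymptotics[OF that a r(2)])
    qed
    have "real n * (LINT t:{0..pi}|lebesgue. norm (qt t)) * (E / norm \<rho>) \<le> C * (E / norm \<rho>)"
      using E r nonneg[of q] by (intro mult_right_mono) (auto simp: C_def)
    also have "\<dots> \<le> E / 8" using r(3,4) E by (simp add: field_simps)
    finally have "norm (char_fun n a qt (\<rho>\<^sup>2) - s_fun \<rho> pi) \<le> E / 8"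
      by (rule order_trans[OF dev[OF qt]])
    moreover have "norm (s_fun \<rho> pi) - norm (char_fun n a qt (\<rho>\<^sup>2))
        \<le> norm (char_fun n a qt (\<rho>\<^sup>2) - s_fun \<rho> pi)"
      by (metis norm_minus_commute norm_triangle_ineq2)
    ultimately have lower: "norm (char_fun n a qt (\<rho>\<^sup>2)) \<ge> E / 8"
      using s by linarith
    have "norm (char_fun n a q (\<rho>\<^sup>2) - char_fun n a qt (\<rho>\<^sup>2))
        \<le> norm (char_fun n a q (\<rho>\<^sup>2) - s_fun \<rho> pi) + norm (char_fun n a qt (\<rho>\<^sup>2) - s_fun \<rho> pi)"
      using norm_triangle_ineq4[of "char_fun n a q (\<rho>\<^sup>2) - s_fun \<rho> pi"
          "char_fun n a qt (\<rho>\<^sup>2) - s_fun \<rho> pi"] by simp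
    also have "\<dots> \<le> C * (E / norm \<rho>)"
      unfolding C_def distrib_right by (intro add_mono dev q qt)
    finally have diff: "norm (char_fun n a q (\<rho>\<^sup>2) - char_fun n a qt (\<rho>\<^sup>2)) \<le> C * (E / norm \<rho>)" .
    have nz: "char_fun n a qt (\<rho>\<^sup>2) \<noteq> 0" using lower E by auto
    then have "norm (char_fun n a q (\<rho>\<^sup>2) / char_fun n a qt (\<rho>\<^sup>2) - 1)
        = norm (char_fun n a q (\<rho>\<^sup>2) - char_fun n a qt (\<rho>\<^sup>2)) / norm (char_fun n a qt (\<rho>\<^sup>2))"
      by (simp add: diff_divide_distrib flip: norm_divide)
    also have "\<dots> \<le> (C * (E / norm \<rho>)) / (E / 8)"
      using diff lower E C0 r by (intro frac_le) auto
    also have "\<dots> = 8 * C / norm \<rho>" using E by simp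
    also have "\<dots> \<le> (8 * C + 1) / real N"
      using r N C0 by (intro frac_le) auto
    finally show ?thesis using nz by blast
  qed
  show ?thesis by (rule that[OF *])
qed

section \<open>The zeros determine the determinant\<close>

text \<open>
  The singularities of \<open>f / g\<close> are removable because \<open>f\<close> vanishes at the zeros of \<open>g\<close> at least to
  the same order. Orders are compared after truncation to natural numbers, which is the form in which
  multiplicities are given.
\<close>

lemma quotient_holomorphic:
  fixes f g :: "complex \<Rightarrow> complex"
  assumes f: "f holomorphic_on UNIV" and g: "g holomorphic_on UNIV"
    and f0: "f w0 \<noteq> 0" and g0: "g w1 \<noteq> 0"
    and ord: "\<And>z. g z = 0 \<Longrightarrow> nat (zorder g z) \<le> nat (zorder f z)"
  obtains h where "h holomorphic_on UNIV" "\<And>z. f z = h z * g z"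
proof -
  define h where "h z = (if g z = 0 then Lim (at z) (\<lambda>w. f w / g w) else f z / g z)" for z
  \<comment> \<open>The last conjunct makes \<open>f z = h z * g z\<close> survive at the zeros of \<open>g\<close>, where the value of
    \<open>h\<close> is a limit.\<close>
  have loc: "\<exists>r>0. \<exists>k. k holomorphic_on ball z r \<and> (\<forall>w\<in>ball z r. h w = k w)
      \<and> (g z = 0 \<longrightarrow> f z = 0)" for z
  proof (cases "g z = 0")
    case False
    have "open {w. g w \<noteq> 0}"
      using g by (intro open_Collect_neq) (auto intro: holomorphic_on_imp_continuous_on)
    then obtain r where r: "r > 0" "ball z r \<subseteq> {w. g w \<noteq> 0}"
      using False by (auto simp: open_contains_ball)
    have "(\<lambda>w. f w / g w) holomorphic_on ball z r"
      using r by (intro holomorphic_on_divide holomorphic_on_subset[OF f] holomorphic_on_subset[OF g]) auto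
    then show ?thesis using r False by (intro exI[of _ r]) (auto simp: h_def subset_iff)
  next
    case True
    obtain r1 where r1: "0 < r1" "zor_poly f z holomorphic_on cball z r1"
        "\<And>w. w \<in> cball z r1 \<Longrightarrow> f w = zor_poly f z w * (w - z) ^ nat (zorder f z) \<and> zor_poly f z w \<noteq> 0"
      and f1: "if f z = 0 then 0 < zorder f z else zorder f z = 0"
      using zorder_exist_zero[OF f open_UNIV connected_UNIV, of z] f0 by blast
    obtain r2 where r2: "0 < r2" "zor_poly g z holomorphic_on cball z r2"
        "\<And>w. w \<in> cball z r2 \<Longrightarrow> g w = zor_poly g z w * (w - z) ^ nat (zorder g z) \<and> zor_poly g z w \<noteq> 0"
      and g1: "if g z = 0 then 0 < zorder g z else zorder g z = 0"
      using zorder_exist_zero[OF g open_UNIV connected_UNIV, of z] g0 by blast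
    define r where "r = min r1 r2"
    define d where "d = nat (zorder f z) - nat (zorder g z)"
    define k where "k w = zor_poly f z w * (w - z) ^ d / zor_poly g z w" for w
    have le: "nat (zorder g z) \<le> nat (zorder f z)" using ord True .
    have hol: "k holomorphic_on ball z r"
      unfolding k_def using r1(3) r2(3)
      by (intro holomorphic_intros holomorphic_on_subset[OF r1(2)] holomorphic_on_subset[OF r2(2)])
         (auto simp: r_def)
    have eq: "f w / g w = k w" "g w \<noteq> 0" if "w \<in> ball z r - {z}" for w
    proof -
      have "nat (zorder f z) = d + nat (zorder g z)" using le by (simp add: d_def)
      then show "f w / g w = k w" "g w \<noteq> 0"
        using that r1(3)[of w] r2(3)[of w] by (auto simp: k_def r_def power_add)
    qed
    have "r > 0" using r1 r2 by (simp add: r_def)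
    then have "isCont k z"
      using hol by (auto simp: continuous_on_eq_continuous_at dest!: holomorphic_on_imp_continuous_on)
    then have "k \<midarrow>z\<rightarrow> k z" by (simp add: isCont_def)
    then have "(\<lambda>w. f w / g w) \<midarrow>z\<rightarrow> k z"
      by (rule Lim_transform_within_open[OF _ open_ball, of _ _ _ _ z r])
         (use \<open>r > 0\<close> eq in \<open>auto simp: dist_commute\<close>)
    then have "h z = k z" using True by (simp add: h_def tendsto_Lim)
    then have "h w = k w" if "w \<in> ball z r" for w
      using eq[of w] that by (cases "w = z") (auto simp: h_def)
    moreover have "f z = 0" using le f1 g1 True by (auto split: if_splits)
    ultimately show ?thesis using hol \<open>r > 0\<close>
      by (intro exI[of _ r] conjI exI[of _ k]) auto
  qed
  have "h holomorphic_on UNIV"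
  proof -
    have "h field_differentiable at z" for z
    proof -
      obtain r k where rk: "r > 0" "k holomorphic_on ball z r" "\<forall>w\<in>ball z r. h w = k w"
        using loc[of z] by blast
      then have "h holomorphic_on ball z r" by (metis holomorphic_cong)
      then show ?thesis using rk(1) by (auto intro: holomorphic_on_imp_differentiable_at)
    qed
    then show ?thesis by (simp add: holomorphic_on_def field_differentiable_at_within)
  qed
  moreover have "f z = h z * g z" for z
    using loc[of z] by (auto simp: h_def)
  ultimately show ?thesis using that by blast
qed

lemma maximum_modulus_square:
  fixes f :: "complex \<Rightarrow> complex"
  assumes f: "f holomorphic_on UNIV"
    and B: "\<And>z. \<bar>Re z\<bar> = R \<or> \<bar>Im z\<bar> = R \<Longrightarrow> norm (f z) \<le> B"
    and z: "norm z \<le> R"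
  shows "norm (f z) \<le> B"
proof (rule maximum_modulus_frontier[where f = f])
  define S where "S = cbox (Complex (-R) (-R)) (Complex R R)"
  show "f holomorphic_on interior S" "continuous_on (closure S) f"
    using f by (auto intro: holomorphic_on_subset holomorphic_on_imp_continuous_on)
  show "bounded S" by (simp add: S_def)
  show "z \<in> S" using z abs_Re_le_cmod[of z] abs_Im_le_cmod[of z]
    by (auto simp: S_def in_cbox_complex_iff)
  show "norm (f w) \<le> B" if "w \<in> frontier S" for w
    using that by (intro B) (auto simp: S_def frontier_def in_cbox_complex_iff box_complex_eq interior_cbox in_box_complex_iff)
qed

text \<open>
  The quotient of the two determinants is entire, and by \<open>char_fun_ratio\<close> it tends to 1 uniformly on
  a sequence of growing squares; the maximum principle makes it constant. The usual
  alternative is Hadamard's factorization of entire functions of order less than 1.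
\<close>

lemma zorder_determines_char_fun:
  assumes n: "n \<ge> 1" and a: "frozen_points n a"
    and q: "set_integrable lebesgue {0..pi} q" and qt: "set_integrable lebesgue {0..pi} qt"
    and ord: "\<And>z. char_fun n a qt z = 0 \<Longrightarrow> nat (zorder (char_fun n a qt) z) \<le> nat (zorder (char_fun n a q) z)"
  shows "char_fun n a q = char_fun n a qt"
proof -
  obtain M where M: "\<And>N \<rho>. \<bar>Re \<rho>\<bar> = real N + 1/2 \<or> \<bar>Im \<rho>\<bar> = real N + 1/2 \<Longrightarrow> real N \<ge> M \<Longrightarrow>
      char_fun n a qt (\<rho>\<^sup>2) \<noteq> 0 \<and>
      norm (char_fun n a q (\<rho>\<^sup>2) / char_fun n a qt (\<rho>\<^sup>2) - 1) \<le> M / real N"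
    using char_fun_ratio[OF n a q qt] by metis
  obtain M' where M': "\<And>N \<rho>. \<bar>Re \<rho>\<bar> = real N + 1/2 \<or> \<bar>Im \<rho>\<bar> = real N + 1/2 \<Longrightarrow> real N \<ge> M' \<Longrightarrow>
      char_fun n a q (\<rho>\<^sup>2) \<noteq> 0"
    using char_fun_ratio[OF n a qt q] by metis
  have hol: "char_fun n a p holomorphic_on UNIV" if p: "set_integrable lebesgue {0..pi} p" for p
  proof -
    have "(\<lambda>lam. frozen_char n a p (csqrt lam)) holomorphic_on UNIV"
      unfolding frozen_char_def
      by (intro holomorphic_intros holomorphic_s_fun holomorphic_I_fun p frozen_points_bounds(2)[OF a])
         auto
    then show ?thesis by (simp add: char_fun_csqrt[OF n] cong: holomorphic_cong)
  qed
  have nz: "\<exists>w. char_fun n a q w \<noteq> 0" "\<exists>w. char_fun n a qt w \<noteq> 0"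
    using M[of "of_real (real (nat \<lceil>M\<rceil>) + 1/2)" "nat \<lceil>M\<rceil>"]
      M'[of "of_real (real (nat \<lceil>M'\<rceil>) + 1/2)" "nat \<lceil>M'\<rceil>"]
    real_nat_ceiling_ge[of M] real_nat_ceiling_ge[of M'] by auto
  then obtain h where h: "h holomorphic_on UNIV" "\<And>z. char_fun n a q z = h z * char_fun n a qt z"
    using quotient_holomorphic[OF hol[OF q] hol[OF qt]] ord by metis
  \<comment> \<open>The squares live in the plane of \<open>\<rho>\<close>, so the maximum principle is applied to
    \<open>\<rho> \<mapsto> h (\<rho>\<^sup>2) - 1\<close>.\<close>
  have "h (\<rho>\<^sup>2) = 1" for \<rho>
  proof -
    have hol2: "(\<lambda>\<rho>. h (\<rho>\<^sup>2) - 1) holomorphic_on UNIV"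
    proof -
      have "(h \<circ> power2) holomorphic_on UNIV"
        by (intro holomorphic_on_compose holomorphic_on_subset[OF h(1)] holomorphic_intros) auto
      then show ?thesis by (auto simp: o_def intro!: holomorphic_intros)
    qed
    have bound: "norm (h (\<rho>\<^sup>2) - 1) \<le> M / real N" if N: "real N \<ge> M" "real N \<ge> norm \<rho>" for N
    proof (rule maximum_modulus_square[OF hol2, where R = "real N + 1/2"])
      fix z :: complex assume z: "\<bar>Re z\<bar> = real N + 1/2 \<or> \<bar>Im z\<bar> = real N + 1/2"
      show "norm (h (z\<^sup>2) - 1) \<le> M / real N"
        using M[OF z N(1)] by (auto simp: h(2))
    qed (use N in auto)
    have "norm (h (\<rho>\<^sup>2) - 1) \<le> 0"
    proof (rule tendsto_lowerbound)
      show "(\<lambda>N. M / real N) \<longlonglongrightarrow> 0" by (rule lim_const_over_n)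
      have "\<forall>\<^sub>F N in sequentially. real N \<ge> max M (norm \<rho>)"
        by (rule filterlim_real_sequentially[unfolded filterlim_at_top, rule_format])
      then show "\<forall>\<^sub>F N in sequentially. norm (h (\<rho>\<^sup>2) - 1) \<le> M / real N"
        by eventually_elim (rule bound, auto)
    qed auto
    then show ?thesis by simp
  qed
  then have "h z = 1" for z by (metis power2_csqrt)
  then show ?thesis using h(2) by auto
qed

section \<open>Completeness of the sines\<close>

lemma sigma_finite_lebesgue: "sigma_finite_measure (lebesgue :: 'a::euclidean_space measure)"
proof
  obtain A :: "'a set set" where A: "countable A" "A \<subseteq> sets lborel" "\<Union>A = space lborel"
      "\<forall>a\<in>A. emeasure lborel a \<noteq> \<infinity>"
    using lborel.sigma_finite_countable by blast
  have "emeasure lebesgue a \<noteq> \<infinity>" if "a \<in> A" for a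
    using A(2,4) that by (auto simp: subset_iff)
  then show "\<exists>A. countable A \<and> A \<subseteq> sets lebesgue \<and> \<Union>A = space (lebesgue :: 'a measure)
      \<and> (\<forall>a\<in>A. emeasure lebesgue a \<noteq> \<infinity>)"
    using A(1-3) by (intro exI[of _ A]) (auto intro: sets_completionI_sets)
qed

text \<open>
  Completeness of the sines in the space of integrable functions. Vanishing against all \<open>sin(kt)\<close>
  propagates to \<open>sin t \<sqdot> p(cos t)\<close> for polynomials \<open>p\<close>, by Weierstrass to \<open>sin t \<sqdot> g(t)\<close> for continuous
  \<open>g\<close>, and by dominated convergence to \<open>sin t\<close> times an indicator function. So \<open>f(t) sin t\<close> has
  integral zero over every measurable set.
\<close>

lemma sine_transform_injective:
  fixes f :: "real \<Rightarrow> complex"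
  assumes f: "set_integrable lebesgue {0..pi} f"
    and zero: "\<And>k::nat. k \<ge> 1 \<Longrightarrow> (LINT t:{0..pi}|lebesgue. f t * of_real (sin (real k * t))) = 0"
  shows "AE t in lebesgue_on {0<..<pi}. f t = 0"
proof -
  define F where "F t = indicator {0..pi} t *\<^sub>R f t" for t
  define J where "J g = (LINT t|lebesgue. F t * complex_of_real (g t))" for g
  have F: "integrable lebesgue F" using f unfolding F_def set_integrable_def .
  have int: "integrable lebesgue (\<lambda>t. F t * complex_of_real (g t))" if "continuous_on {0..pi} g" for g
  proof -
    have "set_integrable lebesgue {0..pi} (\<lambda>t. f t * complex_of_real (g t))"
      by (intro set_integrable_mult_continuous f continuous_intros that)
    then show ?thesis by (simp add: F_def set_integrable_def)
  qed
  have J_add: "J (\<lambda>t. g t + h t) = J g + J h"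
    if "continuous_on {0..pi} g" "continuous_on {0..pi} h" for g h
    using int[OF that(1)] int[OF that(2)] by (simp add: J_def ring_distribs)
  have J_diff: "J (\<lambda>t. g t - h t) = J g - J h"
    if "continuous_on {0..pi} g" "continuous_on {0..pi} h" for g h
    using int[OF that(1)] int[OF that(2)] by (simp add: J_def ring_distribs)
  have J_cmult: "J (\<lambda>t. c * g t) = of_real c * J g" for c g
  proof -
    have "J (\<lambda>t. c * g t) = (LINT t|lebesgue. of_real c * (F t * complex_of_real (g t)))"
      unfolding J_def by (intro Bochner_Integration.integral_cong) auto
    then show ?thesis by (simp only: J_def integral_mult_right_zero)
  qed
  \<comment> \<open>Since \<open>2 sin(kt) cos t = sin((k + 1) t) + sin((k - 1) t)\<close>, multiplication by \<open>cos t\<close>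
    preserves the span of the sines.\<close>
  have trig: "J (\<lambda>t. sin (real k * t) * cos t ^ m) = 0" for m k :: nat
  proof (induction m arbitrary: k)
    case 0
    show ?case
      using zero[of k] by (cases "k = 0") (simp_all add: J_def F_def set_lebesgue_integral_def)
  next
    case (Suc m)
    note IH = Suc.IH
    show ?case
    proof (cases k)
      case 0
      then show ?thesis by (simp add: J_def)
    next
      case (Suc j)
      have "sin (real k * t) * cos t ^ Suc m
          = 1/2 * (sin (real (k + 1) * t) * cos t ^ m) + 1/2 * (sin (real j * t) * cos t ^ m)" for t
      proof -
        have "sin (real (k + 1) * t) + sin (real j * t) = 2 * (sin (real k * t) * cos t)"
        proof -
          have "real (k + 1) * t = real k * t + t" "real j * t = real k * t - t"
            using Suc by (simp_all add: algebra_simps)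
          then show ?thesis by (simp only: sin_add sin_diff)
        qed
        then have "sin (real k * t) * cos t = 1/2 * sin (real (k + 1) * t) + 1/2 * sin (real j * t)"
          by simp
        then show ?thesis by (simp only: power_Suc mult.assoc[symmetric] ring_distribs)
      qed
      then have "J (\<lambda>t. sin (real k * t) * cos t ^ Suc m)
          = J (\<lambda>t. 1/2 * (sin (real (k + 1) * t) * cos t ^ m) + 1/2 * (sin (real j * t) * cos t ^ m))"
        by simp
      also have "\<dots> = J (\<lambda>t. 1/2 * (sin (real (k + 1) * t) * cos t ^ m))
          + J (\<lambda>t. 1/2 * (sin (real j * t) * cos t ^ m))"
        by (rule J_add) (intro continuous_intros)+
      also have "\<dots> = 0" unfolding J_cmult IH by simp
      finally show ?thesis .
    qed
  qed
  have poly: "J (\<lambda>t. sin t * p (cos t)) = 0" if poly_p: "real_polynomial_function p" for p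
  proof -
    obtain c n where p: "p = (\<lambda>x. \<Sum>i\<le>n. c i * x ^ i)"
      using poly_p unfolding real_polynomial_function_iff_sum by blast
    have "J (\<lambda>t. sin t * (\<Sum>i\<le>n. c i * cos t ^ i)) = 0"
    proof (induction n)
      case 0
      show ?case using trig[of 1 0] J_cmult[of "c 0" sin] by (simp add: mult.commute)
    next
      case (Suc n)
      have "J (\<lambda>t. sin t * (\<Sum>i\<le>n. c i * cos t ^ i) + c (Suc n) * (sin t * cos t ^ Suc n))
          = J (\<lambda>t. sin t * (\<Sum>i\<le>n. c i * cos t ^ i)) + J (\<lambda>t. c (Suc n) * (sin t * cos t ^ Suc n))"
        by (rule J_add) (intro continuous_intros)+
      also have "\<dots> = 0"
        using trig[of 1 "Suc n"] unfolding J_cmult Suc.IH by simp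
      finally have "J (\<lambda>t. sin t * (\<Sum>i\<le>n. c i * cos t ^ i) + c (Suc n) * (sin t * cos t ^ Suc n)) = 0" .
      then show ?case by (simp add: ring_distribs mult.left_commute)
    qed
    then show ?thesis by (simp add: p)
  qed
  have cont: "J (\<lambda>t. sin t * g t) = 0" if g: "continuous_on {0..pi} g" for g
  proof -
    define B where "B = (LINT t|lebesgue. norm (F t))"
    \<comment> \<open>As \<open>cos\<close> is injective on \<open>[0,\<pi>]\<close>, every continuous \<open>g\<close> there is a continuous function of
      \<open>cos t\<close>, and hence a uniform limit of polynomials in \<open>cos t\<close>.\<close>
    have h: "continuous_on {-1..1} (\<lambda>x. g (arccos x))"
      by (rule continuous_on_compose2[OF g continuous_on_arccos'])
         (auto intro: arccos_lbound arccos_ubound)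
    have "norm (J (\<lambda>t. sin t * g t)) \<le> B * e" if "e > 0" for e
    proof -
      obtain p where p: "real_polynomial_function p" "\<And>x. x \<in> {-1..1} \<Longrightarrow> \<bar>g (arccos x) - p x\<bar> < e"
        using Stone_Weierstrass_real_polynomial_function[OF compact_Icc h \<open>e > 0\<close>] by metis
      have pc: "continuous_on {0..pi} (\<lambda>t. p (cos t))"
        by (intro continuous_on_compose2[OF continuous_on_polymonial_function[of p UNIV]]
              continuous_intros) (use p(1) in \<open>auto simp: real_polynomial_function_eq\<close>)
      have close: "\<bar>sin t * g t - sin t * p (cos t)\<bar> \<le> e" if "t \<in> {0..pi}" for t
      proof -
        have "\<bar>sin t * g t - sin t * p (cos t)\<bar> = \<bar>sin t\<bar> * \<bar>g (arccos (cos t)) - p (cos t)\<bar>"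
          using that by (simp add: arccos_cos abs_mult flip: right_diff_distrib)
        also have "\<dots> \<le> 1 * e"
          using p(2)[of "cos t"] by (intro mult_mono) (auto intro: less_imp_le)
        finally show ?thesis by simp
      qed
      have "J (\<lambda>t. sin t * g t) = J (\<lambda>t. sin t * g t - sin t * p (cos t))"
        by (subst J_diff) (use poly[OF p(1)] in \<open>auto intro!: continuous_intros g pc\<close>)
      also have "norm \<dots> \<le> (LINT t|lebesgue. norm (F t * of_real (sin t * g t - sin t * p (cos t))))"
        unfolding J_def by (rule integral_norm_bound)
      also have "\<dots> \<le> (LINT t|lebesgue. norm (F t) * e)"
      proof (rule integral_mono)
        show "norm (F t * of_real (sin t * g t - sin t * p (cos t))) \<le> norm (F t) * e" for t
        proof (cases "t \<in> {0..pi}")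
          case True
          then show ?thesis unfolding norm_mult norm_of_real by (intro mult_left_mono close) auto
        qed (auto simp: F_def)
      qed (intro integrable_norm int integrable_mult_left F continuous_intros g pc)+
      also have "\<dots> = B * e" by (simp add: B_def)
      finally show ?thesis .
    qed
    then have "norm (J (\<lambda>t. sin t * g t)) \<le> 0"
    proof (intro tendsto_lowerbound[where F = "at_right 0" and f = "\<lambda>e. B * e"])
      show "((\<lambda>e. B * e) \<longlongrightarrow> 0) (at_right 0)"
        by (auto intro!: tendsto_eq_intros)
    qed (auto simp: eventually_at_right_less eventually_at_filter)
    then show ?thesis by simp
  qed
  have "AE t in lebesgue. F t * of_real (sin t) = 0"
  proof (rule sigma_finite_measure.density_zero[OF sigma_finite_lebesgue])
    show Fs: "integrable lebesgue (\<lambda>t. F t * complex_of_real (sin t))"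
      by (intro int continuous_intros)
    fix A :: "real set" assume A: "A \<in> sets lebesgue"
    have "(indicator A :: real \<Rightarrow> real) measurable_on UNIV"
      using A by (intro lebesgue_measurable_imp_measurable_on) auto
    then obtain N g where N: "negligible N" and g: "\<And>n. continuous_on UNIV (g n)"
        and lim: "\<And>x. x \<notin> N \<Longrightarrow> (\<lambda>n. g n x) \<longlonglongrightarrow> (indicator A x :: real)"
      unfolding measurable_on_def by auto
    \<comment> \<open>Clamping the approximants to \<open>[0,1]\<close> provides the dominating function.\<close>
    define u where "u n t = max 0 (min 1 (g n t))" for n t
    have u: "continuous_on S (u n)" for n S
      unfolding u_def by (intro continuous_intros continuous_on_subset[OF g]) auto
    have "(\<lambda>n. J (\<lambda>t. sin t * u n t)) \<longlonglongrightarrow> (LINT t|lebesgue. F t * of_real (sin t * indicator A t))"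
      unfolding J_def
    proof (rule integral_dominated_convergence[where w = "\<lambda>t. norm (F t)"])
      show "(\<lambda>t. F t * complex_of_real (sin t * indicator A t)) \<in> borel_measurable lebesgue"
      proof -
        have "(\<lambda>t. (F t * complex_of_real (sin t)) * complex_of_real (indicator A t)) \<in> borel_measurable lebesgue"
          by (rule borel_measurable_times[OF borel_measurable_integrable[OF Fs]])
             (use A in \<open>auto intro!: borel_measurable_of_real\<close>)
        then show ?thesis by (simp add: mult.assoc)
      qed
      show "(\<lambda>t. F t * complex_of_real (sin t * u n t)) \<in> borel_measurable lebesgue" for n
        by (intro borel_measurable_integrable int continuous_intros u)
      show "integrable lebesgue (\<lambda>t. norm (F t))" by (intro integrable_norm F)
      have "AE t in lebesgue. t \<notin> N" using N by (simp add: negligible_iff_null_sets AE_not_in)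
      then show "AE t in lebesgue. (\<lambda>n. F t * complex_of_real (sin t * u n t))
          \<longlonglongrightarrow> F t * complex_of_real (sin t * indicator A t)"
      proof eventually_elim
        case (elim t)
        have "(\<lambda>n. u n t) \<longlonglongrightarrow> max 0 (min 1 (indicator A t))"
          unfolding u_def by (intro tendsto_intros lim elim)
        also have "max 0 (min 1 (indicator A t)) = (indicator A t :: real)"
          by (simp add: indicator_def)
        finally show ?case by (intro tendsto_intros)
      qed
      show "AE t in lebesgue. norm (F t * complex_of_real (sin t * u n t)) \<le> norm (F t)" for n
      proof (intro always_eventually allI)
        fix t
        have "\<bar>sin t * u n t\<bar> \<le> 1 * 1" unfolding abs_mult by (intro mult_mono) (auto simp: u_def)
        then have "norm (F t) * \<bar>sin t * u n t\<bar> \<le> norm (F t) * 1" by (intro mult_left_mono) auto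
        then show "norm (F t * complex_of_real (sin t * u n t)) \<le> norm (F t)"
          unfolding norm_mult norm_of_real by simp
      qed
    qed
    moreover have "J (\<lambda>t. sin t * u n t) = 0" for n by (intro cont u)
    ultimately have "(LINT t|lebesgue. F t * of_real (sin t * indicator A t)) = 0"
      by (simp add: LIMSEQ_const_iff)
    also have "(LINT t|lebesgue. F t * of_real (sin t * indicator A t))
        = (LINT t:A|lebesgue. F t * complex_of_real (sin t))"
      unfolding set_lebesgue_integral_def
      by (intro Bochner_Integration.integral_cong) (auto simp: indicator_def)
    finally show "(LINT t:A|lebesgue. F t * complex_of_real (sin t)) = 0" .
  qed
  then have "AE t in lebesgue. t \<in> {0<..<pi} \<longrightarrow> f t = 0"
  proof eventually_elim
    case (elim t)
    then show ?case using sin_gt_zero[of t] by (auto simp: F_def)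
  qed
  then show ?thesis by (simp add: AE_restrict_space_iff)
qed

section \<open>Uniqueness of the potential\<close>

text \<open>
  At an integer the convolution kernel \<open>sin (k (\<pi> - t))\<close> is \<open>\<plusminus> sin(kt)\<close>, so \<open>I(\<pi>)\<close> is a sine
  coefficient of the potential.
\<close>

lemma I_fun_nat:
  fixes k :: nat
  assumes k: "k \<ge> 1"
  shows "I_fun q (of_nat k) pi
     = - ((- 1) ^ k / of_nat k) * (LINT t:{0..pi}|lebesgue. q t * of_real (sin (real k * t)))"
proof -
  have "s_fun (of_nat k) (pi - t) = - ((- 1) ^ k / of_nat k) * of_real (sin (real k * t))" for t
  proof -
    have "sin (real k * (pi - t)) = - ((- 1) ^ k * sin (real k * t))"
      by (simp only: right_diff_distrib sin_diff sin_npi cos_npi mult_zero_left diff_0)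
    then have "sin (of_nat k * complex_of_real (pi - t)) = of_real (- ((- 1) ^ k * sin (real k * t)))"
      by (metis of_real_mult of_real_of_nat_eq sin_of_real)
    then show ?thesis using k by (simp add: s_fun_def)
  qed
  then have "I_fun q (of_nat k) pi
      = (LINT t:{0..pi}|lebesgue. - ((- 1) ^ k / of_nat k) * (q t * of_real (sin (real k * t))))"
    unfolding I_fun_def by (simp add: mult_ac)
  then show ?thesis by (simp only: set_integral_mult_right)
qed

text \<open>
  At \<open>\<rho> = k\<close> the function \<open>s(\<pi>)\<close> vanishes, and with it every term except those that
  carry \<open>I(\<pi>)\<close>.
\<close>

lemma char_fun_nat_square:
  fixes k :: nat
  assumes n: "n \<ge> 1" and k: "k \<ge> 1"
  shows "char_fun n a q ((of_nat k)\<^sup>2) = G_fun n a (of_nat k) / of_nat k * I_fun q (of_nat k) pi"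
proof -
  have "sin (of_nat k * complex_of_real pi) = 0"
    by (metis of_real_0 of_real_mult of_real_of_nat_eq sin_npi sin_of_real)
  then have "s_fun (of_nat k) pi = 0" using k by (simp add: s_fun_def)
  then show ?thesis
    using k by (simp add: char_fun_square[OF n] frozen_char_def G_fun_def s_fun_def
        sum_divide_distrib sum_distrib_right)
qed

text \<open>
  Compare \<open>char_fun_nat_square\<close> for both potentials. The hypothesis on \<open>G_zeros\<close> permits division by
  the factor \<open>G_fun n a k\<close>, so the sine coefficients of the two potentials coincide.
\<close>

lemma potential_determined_by_char_fun:
  assumes n: "n \<ge> 1"
    and q: "set_integrable lebesgue {0..pi} q" and qt: "set_integrable lebesgue {0..pi} qt"
    and G: "G_zeros n a \<inter> of_nat ` {1..} = {}"
    and eq: "char_fun n a q = char_fun n a qt"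
  shows "AE x in lebesgue_on {0<..<pi}. q x = qt x"
proof -
  have int: "set_integrable lebesgue {0..pi} (\<lambda>t. p t * complex_of_real (sin (real k * t)))"
    if "set_integrable lebesgue {0..pi} p" for p and k :: nat
    by (intro set_integrable_mult_continuous that continuous_intros)
  have "(LINT t:{0..pi}|lebesgue. (q t - qt t) * complex_of_real (sin (real k * t))) = 0"
    if k: "k \<ge> 1" for k :: nat
  proof -
    have "of_nat k \<notin> G_zeros n a" using G k by auto
    then have "G_fun n a (of_nat k) \<noteq> 0" by (simp add: G_zeros_def)
    moreover have "G_fun n a (of_nat k) / of_nat k * I_fun q (of_nat k) pi
        = G_fun n a (of_nat k) / of_nat k * I_fun qt (of_nat k) pi"
      using char_fun_nat_square[OF n k] eq by metis
    ultimately have "I_fun q (of_nat k) pi = I_fun qt (of_nat k) pi" using k by simp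
    then have "(LINT t:{0..pi}|lebesgue. q t * complex_of_real (sin (real k * t)))
        = (LINT t:{0..pi}|lebesgue. qt t * complex_of_real (sin (real k * t)))"
      using k by (simp add: I_fun_nat)
    then show ?thesis
      by (simp add: left_diff_distrib set_integral_diff(2)[OF int[OF q] int[OF qt]])
  qed
  then have "AE t in lebesgue_on {0<..<pi}. q t - qt t = 0"
    by (intro sine_transform_injective set_integral_diff(1)[OF q qt]) auto
  then show ?thesis by simp
qed

lemma one_point_zeros:
  assumes a: "0 < a 1"
  shows "G_zeros 1 a \<inter> of_nat ` {1..} = {} \<longleftrightarrow> pi / a 1 \<notin> \<rat>"
proof -
  have G: "of_nat k \<in> G_zeros 1 a \<longleftrightarrow> (\<exists>m::int. real k * a 1 = of_int m * pi)" for k :: nat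
  proof -
    have "G_fun 1 a (of_nat k) = complex_of_real (sin (real k * a 1))"
      by (simp add: G_fun_def flip: sin_of_real)
    then show ?thesis by (simp add: G_zeros_def sin_zero_iff_int2)
  qed
  have "pi / a 1 \<in> \<rat> \<longleftrightarrow> (\<exists>k\<ge>1. \<exists>m::int. real k * a 1 = of_int m * pi)"
  proof
    assume "pi / a 1 \<in> \<rat>"
    moreover have "pi / a 1 > 0" using a by simp
    ultimately obtain m k :: nat where mk: "k \<noteq> 0" "m \<noteq> 0" "pi / a 1 = real k / real m"
      by (metis Rats_abs_nat_div_natE abs_of_pos divide_eq_0_iff less_irrefl of_nat_0)
    then have "real k * a 1 = of_int (int m) * pi" using a by (simp add: field_simps)
    then show "\<exists>k\<ge>1. \<exists>m::int. real k * a 1 = of_int m * pi"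
      using mk(1) by (intro exI[of _ k]) (auto intro!: exI[of _ "int m"])
  next
    assume "\<exists>k\<ge>1. \<exists>m::int. real k * a 1 = of_int m * pi"
    then obtain k :: nat and m :: int where km: "k \<ge> 1" "real k * a 1 = of_int m * pi" by blast
    have "m \<noteq> 0" using km a by auto
    then have "pi / a 1 = of_nat k / of_int m" using km a by (simp add: field_simps)
    then show "pi / a 1 \<in> \<rat>" by simp
  qed
  then show ?thesis using G by auto
qed

theorem theorem2p3:
  fixes n :: nat and a :: "nat \<Rightarrow> real" and q qt :: "real \<Rightarrow> complex"
  assumes "n \<ge> 1"
    and "frozen_points n a"
    and "L2_potential q" and "L2_potential qt"
  shows "(G_zeros n a \<inter> of_nat ` {1..} = {} \<and> spectrum_mult n a q = spectrum_mult n a qt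
            \<longrightarrow> (AE x in lebesgue_on {0<..<pi}. q x = qt x))
       \<and> (n = 1 \<longrightarrow> (G_zeros n a \<inter> of_nat ` {1..} = {} \<longleftrightarrow> pi / a 1 \<notin> \<rat>))"
proof (intro conjI impI)
  assume *: "G_zeros n a \<inter> of_nat ` {1..} = {} \<and> spectrum_mult n a q = spectrum_mult n a qt"
  note q = set_integrable_L2_potential[OF assms(3)] and qt = set_integrable_L2_potential[OF assms(4)]
  have "nat (zorder (char_fun n a qt) z) \<le> nat (zorder (char_fun n a q) z)"
    if "char_fun n a qt z = 0" for z
  proof -
    have "bvp_eigenvalue n a qt z"
      by (rule char_fun_zero_imp_eigenvalue[OF assms(1,2) qt that])
    then have "nat (zorder (char_fun n a qt) z) = spectrum_mult n a q z"
      using * by (simp add: spectrum_mult_def)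
    then show ?thesis by (simp add: spectrum_mult_def split: if_splits)
  qed
  then have "char_fun n a q = char_fun n a qt"
    by (rule zorder_determines_char_fun[OF assms(1,2) q qt])
  with * show "AE x in lebesgue_on {0<..<pi}. q x = qt x"
    by (intro potential_determined_by_char_fun[OF assms(1) q qt]) auto
next
  assume n: "n = 1"
  then have "0 < a 1" using assms(2) by (simp add: frozen_points_def)
  then show "G_zeros n a \<inter> of_nat ` {1..} = {} \<longleftrightarrow> pi / a 1 \<notin> \<rat>"
    unfolding n by (rule one_point_zeros)
qed

end
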